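(* Let $n\ge 1$, let $\alpha>1$ be real, and let $m\in\{j/2^n: 0\le j\le 2^n\}$ be fixed. For $\epsilon\in[0,1/2]$ and a Boolean function $f$, write $M_\epsilon(f)=\mathbb{E}(T_\epsilon f)^\alpha$, and let $\mathcal{B}_m$ be the set of Boolean functions $f:\{0,1\}^n\to\{0,1\}$ with $\mathbb{E} f=m$. (i) There exists $\epsilon_0\in(0,1/2]$ (depending on $n,\alpha,m$) such that for every $\epsilon\in(0,\epsilon_0)$, the lexicographic function $L_m\in\mathcal{B}_m$ satisfies $M_\epsilon(L_m)\ge M_\epsilon(f)$ for all $f\in\mathcal{B}_m$. (ii) There exists $\epsilon_1\in[0,1/2)$ (depending on $n,\alpha,m$) such that for every $\epsilon\in(\epsilon_1,1/2)$, every $f\in\mathcal{B}_m$ maximizing $M_\epsilon$ over $\mathcal{B}_m$ satisfies $W_1(f)=\max\{W_1(g): g\in\mathcal{B}_m\}$. (iii) If $m=1/2$, there exist $\epsilon_0\in(0,1/2]$ and $\epsilon_1\in[0,1/2)$ such that for every $\epsilon\in(0,\epsilon_0)\cup(\epsilon_1,1/2)$, the dictator function $d(x)=x_1$ satisfies $M_\epsilon(d)\ge M_\epsilon(f)$ for all $f\in\mathcal{B}_{1/2}$.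
   Context: $\{0,1\}^n$ carries the uniform probability measure; $\mathbb{E}$ denotes expectation with respect to it. A Boolean function is a map $f:\{0,1\}^n\to\{0,1\}$. For $0\le\epsilon\le 1/2$, the noise operator is $T_\epsilon f(x)=\mathbb{E} f(x+Z)$, where $Z\in\{0,1\}^n$ has independent Bernoulli($\epsilon$) coordinates and addition is coordinatewise mod 2. For $A\subseteq[n]$, $W_A(x)=(-1)^{\sum_{i\in A}x_i}$ and $\hat f(A)=\mathbb{E}(fW_A)$; the degree-1 Fourier weight of $f$ is $W_1(f)=\sum_{i=1}^n\hat f(\{i\})^2$. The lexicographic function $L_m$ of mean $m$ is the indicator of the set consisting of the first $m2^n$ elements of $\{0,1\}^n$ in lexicographic order. The dictator function is $d(x)=x_1$. *)

theory Defs
  imports Complex_Main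
begin

text \<open>Points of the discrete cube {0,1}^n are boolean lists of length n;
  coordinate i (1-based in the paper) is x ! (i-1); True stands for 1.
  A Boolean function is f :: bool list => bool, only its values on the cube matter.\<close>

definition cube :: "nat \<Rightarrow> bool list set" where
  "cube n = {x. length x = n}"

definition expect :: "nat \<Rightarrow> (bool list \<Rightarrow> real) \<Rightarrow> real" where
  "expect n g = (\<Sum>x\<in>cube n. g x) / 2 ^ n"

definition xorv :: "bool list \<Rightarrow> bool list \<Rightarrow> bool list" where
  "xorv x z = map2 (\<lambda>a b. a \<noteq> b) x z"

definition noise_prob :: "real \<Rightarrow> bool list \<Rightarrow> real" where
  "noise_prob eps z = (\<Prod>i<length z. if z ! i then eps else 1 - eps)"

definition noise_op :: "nat \<Rightarrow> real \<Rightarrow> (bool list \<Rightarrow> bool) \<Rightarrow> bool list \<Rightarrow> real" where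
  "noise_op n eps f x = (\<Sum>z\<in>cube n. noise_prob eps z * of_bool (f (xorv x z)))"

definition Mfun :: "nat \<Rightarrow> real \<Rightarrow> real \<Rightarrow> (bool list \<Rightarrow> bool) \<Rightarrow> real" where
  "Mfun n alpha eps f = expect n (\<lambda>x. noise_op n eps f x powr alpha)"

definition bmean :: "nat \<Rightarrow> (bool list \<Rightarrow> bool) \<Rightarrow> real" where
  "bmean n f = expect n (\<lambda>x. of_bool (f x))"

definition Bm :: "nat \<Rightarrow> real \<Rightarrow> (bool list \<Rightarrow> bool) set" where
  "Bm n m = {f. bmean n f = m}"

definition fourier1 :: "nat \<Rightarrow> (bool list \<Rightarrow> bool) \<Rightarrow> nat \<Rightarrow> real" where
  "fourier1 n f i = expect n (\<lambda>x. of_bool (f x) * (if x ! i then -1 else 1))"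

definition W1 :: "nat \<Rightarrow> (bool list \<Rightarrow> bool) \<Rightarrow> real" where
  "W1 n f = (\<Sum>i<n. (fourier1 n f i)\<^sup>2)"

text \<open>Position of x in lexicographic order on {0,1}^n (0 < 1, first coordinate most
  significant), counting from 0.\<close>
definition lex_index :: "bool list \<Rightarrow> nat" where
  "lex_index x = (\<Sum>i<length x. (if x ! i then 2 ^ (length x - 1 - i) else 0))"

definition lexfun :: "nat \<Rightarrow> real \<Rightarrow> bool list \<Rightarrow> bool" where
  "lexfun n m x = (real (lex_index x) < m * 2 ^ n)"

definition dictator :: "bool list \<Rightarrow> bool" where
  "dictator x = x ! 0"

end

theory Submission
  imports Defs
begin

text \<open>
  For a set \<open>A\<close> the expansion at \<open>\<epsilon> = 0\<close> is \<open>M = m - \<alpha> \<epsilon> b / 2^n + o(\<epsilon>)\<close>, where \<open>b\<close> is the edge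
  boundary of \<open>A\<close>: points outside \<open>A\<close> only contribute \<open>O(\<epsilon>^\<alpha>)\<close>. So small noise prefers sets of
  minimal edge boundary. The higher-order terms need not be examined, because minimisers of a given size
  are unique up to Hamming isometries: an optimal set with at most half of the points lies in a face,
  and complements reduce the other sizes to this one.

  At \<open>\<epsilon> = 1/2\<close> a second-order Taylor expansion of the power around the mean \<open>m\<close> gives
  \<open>M = m^\<alpha> + 2 \<alpha> (\<alpha> - 1) m^(\<alpha> - 2) W_1 (\<epsilon> - 1/2)^2 + o((\<epsilon> - 1/2)^2)\<close>; the first-order term vanishes
  since the noise operator preserves the mean. For \<open>m = 1/2\<close> Parseval bounds \<open>W_1\<close> by \<open>1/4\<close>, with
  equality only for dictators and their negations.
\<close>

section \<open>Hamming distance and isometries of the cube\<close>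

text \<open>The recursion peels off the first coordinate, along which inductions over the dimension
  split the cube. The second clause ends it at the shorter list; the proof compares points of one
  cube only.\<close>

fun hdist :: "bool list \<Rightarrow> bool list \<Rightarrow> nat" where
  "hdist (a # x) (b # y) = of_bool (a \<noteq> b) + hdist x y"
| "hdist _ _ = 0"

lemma cube_0 [simp]: "cube 0 = {[]}"
  by (auto simp: cube_def)

lemma cube_Suc: "cube (Suc n) = Cons False ` cube n \<union> Cons True ` cube n"
proof -
  have "x \<in> Cons False ` cube n \<union> Cons True ` cube n" if "length x = Suc n" for x
    using that by (cases x; cases "hd x") (auto simp: cube_def)
  then show ?thesis
    by (auto simp: cube_def)
qed

lemma Cons_mem_cube [simp]: "b # x \<in> cube (Suc n) \<longleftrightarrow> x \<in> cube n"
  by (simp add: cube_def)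

lemma cube_SucE:
  assumes "x \<in> cube (Suc n)"
  obtains b y where "x = b # y" "y \<in> cube n"
  using assms by (auto simp: cube_Suc)

lemma finite_cube [simp]: "finite (cube n)"
  by (induction n) (auto simp: cube_Suc)

lemma finite_subset_cube: "A \<subseteq> cube n \<Longrightarrow> finite A"
  using finite_subset by fastforce

lemma card_cube [simp]: "card (cube n) = 2 ^ n"
proof (induction n)
  case (Suc n)
  have "card (cube (Suc n)) = card (Cons False ` cube n) + card (Cons True ` cube n)"
    unfolding cube_Suc by (intro card_Un_disjoint) auto
  then show ?case
    using Suc by (simp add: card_image)
qed simp

lemma hdist_sym: "hdist x y = hdist y x"
  by (induction x y rule: hdist.induct) auto

lemma hdist_refl [simp]: "hdist x x = 0"
  by (induction x) auto

lemma hdist_le: "hdist x y \<le> length x"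
  by (induction x y rule: hdist.induct) auto

lemma hdist_0_iff: "length x = length y \<Longrightarrow> hdist x y = 0 \<longleftrightarrow> x = y"
  by (induction x y rule: hdist.induct) auto

lemma hdist_0_cube: "x \<in> cube n \<Longrightarrow> y \<in> cube n \<Longrightarrow> hdist x y = 0 \<longleftrightarrow> x = y"
  by (simp add: cube_def hdist_0_iff)

lemma hdist_append:
  "length x = length x' \<Longrightarrow> hdist (x @ y) (x' @ y') = hdist x x' + hdist y y'"
  by (induction x x' rule: list_induct2) auto

text \<open>Preserving distances inside the cube is enough: distinct points stay distinct, and an
  injective self-map of a finite set is onto.\<close>

definition isometry :: "nat \<Rightarrow> (bool list \<Rightarrow> bool list) \<Rightarrow> bool" where
  "isometry n \<phi> \<longleftrightarrow> \<phi> ` cube n \<subseteq> cube n \<and>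
     (\<forall>x\<in>cube n. \<forall>y\<in>cube n. hdist (\<phi> x) (\<phi> y) = hdist x y)"

definition isometric :: "nat \<Rightarrow> bool list set \<Rightarrow> bool list set \<Rightarrow> bool" where
  "isometric n A B \<longleftrightarrow> A \<subseteq> cube n \<and> (\<exists>\<phi>. isometry n \<phi> \<and> \<phi> ` A = B)"

lemma isometry_inj: "isometry n \<phi> \<Longrightarrow> inj_on \<phi> (cube n)"
  by (rule inj_onI) (metis hdist_0_cube hdist_refl isometry_def)

lemma isometry_surj: "isometry n \<phi> \<Longrightarrow> \<phi> ` cube n = cube n"
  using endo_inj_surj[OF finite_cube] isometry_inj isometry_def by metis

lemma isometric_subset: "isometric n A B \<Longrightarrow> B \<subseteq> cube n"
  by (force simp: isometric_def isometry_def)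

lemma isometric_card: "isometric n A B \<Longrightarrow> card B = card A"
  by (metis card_image inj_on_subset isometric_def isometry_inj)

lemma isometric_trans: "isometric n A B \<Longrightarrow> isometric n B C \<Longrightarrow> isometric n A C"
  unfolding isometric_def
proof (elim conjE exE)
  fix \<phi> \<psi>
  assume "isometry n \<phi>" "isometry n \<psi>" and A: "A \<subseteq> cube n" "\<phi> ` A = B" "\<psi> ` B = C"
  then have "isometry n (\<psi> \<circ> \<phi>)"
    by (auto simp: isometry_def image_subset_iff)
  then show "A \<subseteq> cube n \<and> (\<exists>\<phi>. isometry n \<phi> \<and> \<phi> ` A = C)"
    using A by (metis image_comp)
qed

lemma isometric_sum_pair:
  assumes "isometric n A B"
  shows "(\<Sum>x\<in>B. \<Sum>y\<in>B. g (hdist x y)) = (\<Sum>x\<in>A. \<Sum>y\<in>A. g (hdist x y))"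
proof -
  obtain \<phi> where \<phi>: "isometry n \<phi>" and A: "A \<subseteq> cube n" and B: "B = \<phi> ` A"
    using assms by (auto simp: isometric_def)
  have inj: "inj_on \<phi> A"
    using A \<phi> inj_on_subset isometry_inj by blast
  show ?thesis
    unfolding B sum.reindex[OF inj] o_def using A \<phi>
    by (intro sum.cong refl) (auto simp: isometry_def subset_iff)
qed

lemma isometry_lift:
  assumes "isometry n \<phi>"
  shows "isometry (Suc n) (\<lambda>x. hd x # \<phi> (tl x))"
  using assms by (auto simp: isometry_def cube_Suc)

lemma isometry_flip_head: "isometry (Suc n) (\<lambda>x. (\<not> hd x) # tl x)"
  by (auto simp: isometry_def cube_Suc)

text \<open>A permutation of coordinates. Cutting both points at position \<open>i\<close> makes
  this visible, since the distance is additive over concatenation.\<close>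

lemma isometry_move_to_head:
  assumes "i < n"
  shows "isometry n (\<lambda>x. x ! i # take i x @ drop (Suc i) x)"
  unfolding isometry_def
proof (intro conjI ballI)
  show "(\<lambda>x. x ! i # take i x @ drop (Suc i) x) ` cube n \<subseteq> cube n"
    using assms by (auto simp: cube_def)
next
  fix x y assume "x \<in> cube n" "y \<in> cube n"
  then have l: "length x = n" "length y = n"
    by (simp_all add: cube_def)
  have "hdist x y = hdist (take i x @ x ! i # drop (Suc i) x) (take i y @ y ! i # drop (Suc i) y)"
    using assms l by (simp flip: id_take_nth_drop)
  also have "\<dots> = hdist (x ! i # take i x @ drop (Suc i) x) (y ! i # take i y @ drop (Suc i) y)"
    using l by (simp add: hdist_append)
  finally show "hdist (x ! i # take i x @ drop (Suc i) x) (y ! i # take i y @ drop (Suc i) y) = hdist x y"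
    by simp
qed

text \<open>Coordinate \<open>i\<close> is moved to the front and, if \<open>b\<close> differs from
  \<open>c\<close>, the head is then negated.\<close>

lemma isometric_face_head:
  assumes "A \<subseteq> cube (Suc n)" "i < Suc n" "\<forall>x\<in>A. x ! i = c"
  obtains B where "isometric (Suc n) A B" "\<forall>x\<in>B. hd x = b"
proof -
  define \<mu> where "\<mu> = (\<lambda>x::bool list. x ! i # take i x @ drop (Suc i) x)"
  have 1: "isometric (Suc n) A (\<mu> ` A)"
    using assms isometry_move_to_head[OF assms(2)] by (auto simp: isometric_def \<mu>_def)
  have hd1: "\<forall>x\<in>\<mu> ` A. hd x = c"
    using assms(3) by (simp add: \<mu>_def)
  show thesis
  proof (cases "b = c")
    case True
    then show thesis using that[OF 1] hd1 by blast
  next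
    case False
    have "isometric (Suc n) (\<mu> ` A) ((\<lambda>x. (\<not> hd x) # tl x) ` \<mu> ` A)"
      using isometric_subset[OF 1] isometry_flip_head by (auto simp: isometric_def)
    then have "isometric (Suc n) A ((\<lambda>x. (\<not> hd x) # tl x) ` \<mu> ` A)"
      using isometric_trans 1 by blast
    moreover have "\<forall>x\<in>(\<lambda>x. (\<not> hd x) # tl x) ` \<mu> ` A. hd x = b"
      using hd1 False by auto
    ultimately show thesis using that by blast
  qed
qed

section \<open>The edge-isoperimetric function\<close>

text \<open>The largest number of edges spanned by \<open>k\<close> points of a cube, which is the number of binary
  digits 1 in the numbers below \<open>k\<close>.\<close>

fun max_edges :: "nat \<Rightarrow> nat" where
  "max_edges k = (if k \<le> 1 then 0
     else max_edges (k div 2) + max_edges (k - k div 2) + k div 2)"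

declare max_edges.simps [simp del]

lemma max_edges_base [simp]: "max_edges 0 = 0" "max_edges (Suc 0) = 0"
  by (simp_all add: max_edges.simps)

lemma max_edges_even: "max_edges (2 * k) = 2 * max_edges k + k"
  by (cases "k = 0") (simp, subst max_edges.simps, simp)

lemma max_edges_odd: "max_edges (2 * k + 1) = max_edges k + max_edges (k + 1) + k"
proof (cases "k = 0")
  case False
  have "(2 * k + 1) div 2 = k" "2 * k + 1 - k = k + 1" by auto
  then show ?thesis
    using False by (subst max_edges.simps) simp
qed simp

text \<open>Induction on the sum, by parity. Each half of \<open>a + b\<close> is composed of a half
  of \<open>a\<close> and a half of \<open>b\<close>. When both are odd, the smaller half of one
  joins the larger half of the other, and the recursion for \<open>a + b\<close> yields
  \<open>p + q + 1\<close> instead of \<open>p + q\<close>; this covers the unit by which the two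
  minima can fall short.\<close>

lemma max_edges_superadd:
  "max_edges a + max_edges b + min a b \<le> max_edges (a + b)"
proof (induction "a + b" arbitrary: a b rule: less_induct)
  case less
  define p q where "p = a div 2" and "q = b div 2"
  note E = max_edges_even and O = max_edges_odd
  consider "a + b \<le> 1" | "a + b \<ge> 2" "a = 2 * p" "b = 2 * q"
    | "a + b \<ge> 2" "a = 2 * p + 1" "b = 2 * q" | "a + b \<ge> 2" "a = 2 * p" "b = 2 * q + 1"
    | "a + b \<ge> 2" "a = 2 * p + 1" "b = 2 * q + 1"
    unfolding p_def q_def by linarith
  then show ?case
  proof cases
    case 1
    then have "(a = 0 \<or> a = 1) \<and> (b = 0 \<or> b = 1) \<and> \<not> (a = 1 \<and> b = 1)" by linarith
    then show ?thesis by auto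
  next
    case 2
    have "max_edges p + max_edges q + min p q \<le> max_edges (p + q)"
      using 2 by (intro less) linarith
    moreover have "a + b = 2 * (p + q)" using 2 by simp
    ultimately show ?thesis
      unfolding 2 using E[of p] E[of q] E[of "p + q"] by (simp add: min_def split: if_splits)
  next
    case 3
    have "max_edges p + max_edges q + min p q \<le> max_edges (p + q)"
      and "max_edges (p + 1) + max_edges q + min (p + 1) q \<le> max_edges (p + 1 + q)"
      using 3 by (intro less; linarith)+
    moreover have "max_edges (a + b) = max_edges (p + q) + max_edges (p + 1 + q) + (p + q)"
      using O[of "p + q"] 3(2,3) by simp
    moreover have "min p q + min (p + 1) q = min (2 * p + 1) (2 * q)" by linarith
    moreover have "max_edges a = max_edges p + max_edges (p + 1) + p" "max_edges b = 2 * max_edges q + q"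
      unfolding 3(2,3) O E by simp_all
    ultimately show ?thesis
      using 3(2,3) by linarith
  next
    case 4
    have "max_edges p + max_edges q + min p q \<le> max_edges (p + q)"
      and "max_edges p + max_edges (q + 1) + min p (q + 1) \<le> max_edges (p + (q + 1))"
      using 4 by (intro less; linarith)+
    moreover have "max_edges (a + b) = max_edges (p + q) + max_edges (p + (q + 1)) + (p + q)"
      using O[of "p + q"] 4(2,3) by simp
    moreover have "min p q + min p (q + 1) = min (2 * p) (2 * q + 1)" by linarith
    moreover have "max_edges b = max_edges q + max_edges (q + 1) + q" "max_edges a = 2 * max_edges p + p"
      unfolding 4(2,3) O E by simp_all
    ultimately show ?thesis
      using 4(2,3) by linarith
  next
    case 5
    have "max_edges p + max_edges (q + 1) + min p (q + 1) \<le> max_edges (p + (q + 1))"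
      and "max_edges (p + 1) + max_edges q + min (p + 1) q \<le> max_edges (p + 1 + q)"
      using 5 by (intro less; linarith)+
    moreover have "max_edges (a + b) = max_edges (p + (q + 1)) + max_edges (p + 1 + q) + (p + q + 1)"
      using E[of "p + q + 1"] 5(2,3) by simp
    moreover have "min p (q + 1) + min (p + 1) q + 1 \<ge> min (2 * p + 1) (2 * q + 1)" by linarith
    moreover have "max_edges a = max_edges p + max_edges (p + 1) + p"
        "max_edges b = max_edges q + max_edges (q + 1) + q"
      unfolding 5(2,3) O by simp_all
    ultimately show ?thesis
      using 5(2,3) by linarith
  qed
qed

text \<open>For \<open>j < 2 ^ d\<close> the number \<open>2 ^ d + j\<close> has exactly one binary
  digit 1 more than \<open>j\<close>. Thus superadditivity is an equality when the larger summand is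
  a power of two.\<close>

lemma max_edges_power2_add:
  "x \<le> 2 ^ d \<Longrightarrow> max_edges (2 ^ d + x) = max_edges (2 ^ d) + max_edges x + x"
proof (induction d arbitrary: x)
  case 0
  then have "x = 0 \<or> x = 1" by auto
  then show ?case
    using max_edges_even[of 1] by (auto simp: numeral_2_eq_2)
next
  case (Suc d)
  define y where "y = x div 2"
  define N :: nat where "N = 2 ^ d"
  have N: "2 ^ Suc d = 2 * N" by (simp add: N_def)
  consider "x = 2 * y" | "x = 2 * y + 1" unfolding y_def by linarith
  then show ?case
  proof cases
    case 1
    have "max_edges (N + y) = max_edges N + max_edges y + y"
      using 1 Suc by (simp add: N_def)
    moreover have "max_edges (2 * N + x) = 2 * max_edges (N + y) + (N + y)"
      using max_edges_even[of "N + y"] 1 by simp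
    ultimately show ?thesis
      using 1 max_edges_even[of y] max_edges_even[of N] unfolding N by simp
  next
    case 2
    have "max_edges (N + y) = max_edges N + max_edges y + y"
      "max_edges (N + (y + 1)) = max_edges N + max_edges (y + 1) + (y + 1)"
      using 2 Suc.prems unfolding N_def by (intro Suc.IH; simp)+
    moreover have "max_edges (2 * N + x) = max_edges (N + y) + max_edges (N + (y + 1)) + (N + y)"
      using max_edges_odd[of "N + y"] 2 by (simp add: algebra_simps)
    ultimately show ?thesis
      using 2 max_edges_odd[of y] max_edges_even[of N] unfolding N by simp
  qed
qed

text \<open>Ordered pairs, so this is twice the number of edges inside \<open>A\<close>.\<close>

definition adjacent_pairs :: "bool list set \<Rightarrow> nat" where
  "adjacent_pairs A = (\<Sum>x\<in>A. \<Sum>y\<in>A. of_bool (hdist x y = 1))"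

section \<open>Edges of a set and of its two sections\<close>

definition face_section :: "bool \<Rightarrow> bool list set \<Rightarrow> bool list set" where
  "face_section b A = {x. b # x \<in> A}"

lemma face_section_subset: "A \<subseteq> cube (Suc n) \<Longrightarrow> face_section b A \<subseteq> cube n"
  by (force simp: face_section_def)

lemma face_section_Un:
  assumes "A \<subseteq> cube (Suc n)"
  shows "A = Cons False ` face_section False A \<union> Cons True ` face_section True A"
proof -
  have "x \<in> Cons False ` face_section False A \<union> Cons True ` face_section True A" if x: "x \<in> A" for x
  proof -
    obtain b y where "x = b # y"
      using assms x cube_SucE by blast
    then show ?thesis
      using x by (cases b) (auto simp: face_section_def)
  qed
  then show ?thesis
    by (auto simp: face_section_def)
qed

lemma sum_face_section:
  assumes "A \<subseteq> cube (Suc n)"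
  shows "(\<Sum>x\<in>A. g x) = (\<Sum>x\<in>face_section False A. g (False # x)) + (\<Sum>x\<in>face_section True A. g (True # x))"
proof -
  have "finite (face_section b A)" for b
    using face_section_subset[OF assms] finite_subset_cube by blast
  then have "sum g A = sum g (Cons False ` face_section False A) + sum g (Cons True ` face_section True A)"
    by (subst face_section_Un[OF assms], intro sum.union_disjoint) auto
  then show ?thesis
    by (simp add: sum.reindex)
qed

lemma card_face_section:
  "A \<subseteq> cube (Suc n) \<Longrightarrow> card A = card (face_section False A) + card (face_section True A)"
  using sum_face_section[of A n "\<lambda>_. 1::nat"] by simp

text \<open>Points in opposite halves of a cube are adjacent exactly when their tails coincide, so
  for two sections this double sum counts the edges across the first coordinate.\<close>

lemma sum_hdist_eq_0:
  assumes "A \<subseteq> cube n" "B \<subseteq> cube n"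
  shows "(\<Sum>x\<in>A. \<Sum>y\<in>B. of_bool (hdist x y = 0)) = card (A \<inter> B)"
proof -
  have fin: "finite A" "finite B"
    using assms finite_subset_cube by blast+
  have "(\<Sum>y\<in>B. of_bool (hdist x y = 0)) = (if x \<in> B then 1 else 0 :: nat)" if "x \<in> A" for x
  proof -
    have "(\<Sum>y\<in>B. of_bool (hdist x y = 0)) = (\<Sum>y\<in>B. if x = y then 1 else 0 :: nat)"
      using assms that by (intro sum.cong refl) (auto simp: hdist_0_cube[of _ n] subset_iff)
    then show ?thesis
      using fin by simp
  qed
  then have "(\<Sum>x\<in>A. \<Sum>y\<in>B. of_bool (hdist x y = 0)) = (\<Sum>x\<in>A. if x \<in> B then 1 else 0 :: nat)"
    by (intro sum.cong refl)
  also have "\<dots> = (\<Sum>x\<in>A \<inter> B. 1)"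
    using fin(1) by (rule sum.inter_restrict[symmetric])
  finally show ?thesis by simp
qed

text \<open>An edge inside \<open>A\<close> lies in one half or joins two points with a common tail;
  a crossing edge is met in both orders, whence the factor 2.\<close>

lemma adjacent_pairs_split:
  assumes "A \<subseteq> cube (Suc n)"
  shows "adjacent_pairs A = adjacent_pairs (face_section False A) + adjacent_pairs (face_section True A)
    + 2 * card (face_section False A \<inter> face_section True A)"
proof -
  let ?F = "face_section False A" and ?T = "face_section True A"
  have sub: "?F \<subseteq> cube n" "?T \<subseteq> cube n"
    using face_section_subset[OF assms] by auto
  note FT = sum_hdist_eq_0[OF sub]
  have TF: "(\<Sum>x\<in>?T. \<Sum>y\<in>?F. of_bool (hdist x y = 0)) = card (?F \<inter> ?T)"
    using sum_hdist_eq_0[OF sub(2,1)] by (simp only: Int_commute)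
  show ?thesis
    unfolding adjacent_pairs_def sum_face_section[OF assms]
    using FT TF by (simp add: sum.distrib)
qed

text \<open>The edge-isoperimetric inequality of the cube. The edges across the first coordinate
  number at most the size of the smaller section, which is the term supplied by
  \<open>max_edges_superadd\<close>.\<close>

lemma adjacent_pairs_le: "A \<subseteq> cube n \<Longrightarrow> adjacent_pairs A \<le> 2 * max_edges (card A)"
proof (induction n arbitrary: A)
  case 0
  then have "A = {} \<or> A = {[]}" by auto
  then show ?case by (auto simp: adjacent_pairs_def)
next
  case (Suc n)
  let ?F = "face_section False A" and ?T = "face_section True A"
  have sub: "?F \<subseteq> cube n" "?T \<subseteq> cube n"
    using face_section_subset[OF Suc.prems] by auto
  have "card (?F \<inter> ?T) \<le> min (card ?F) (card ?T)"
    using sub finite_subset_cube by (auto intro: card_mono)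
  then show ?case
    using Suc.IH[OF sub(1)] Suc.IH[OF sub(2)] max_edges_superadd[of "card ?F" "card ?T"]
    unfolding adjacent_pairs_split[OF Suc.prems] card_face_section[OF Suc.prems] by linarith
qed

text \<open>Equality in \<open>adjacent_pairs_le\<close> makes every inequality of its induction
  step an equality. In particular the sections meet in as many points as the smaller one has, so
  they are nested.\<close>

lemma optimal_section:
  assumes A: "A \<subseteq> cube (Suc n)" "adjacent_pairs A = 2 * max_edges (card A)"
  defines "F \<equiv> face_section False A" and "T \<equiv> face_section True A"
  shows "adjacent_pairs F = 2 * max_edges (card F)" "adjacent_pairs T = 2 * max_edges (card T)"
    "max_edges (card A) = max_edges (card F) + max_edges (card T) + min (card F) (card T)"
    "F \<subseteq> T \<or> T \<subseteq> F"
proof -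
  have sub: "F \<subseteq> cube n" "T \<subseteq> cube n"
    using face_section_subset[OF A(1)] by (auto simp: F_def T_def)
  then have fin: "finite F" "finite T"
    using finite_subset_cube by blast+
  have I: "card (F \<inter> T) \<le> min (card F) (card T)"
    using fin by (auto intro: card_mono)
  have card: "card A = card F + card T"
    using card_face_section[OF A(1)] by (simp add: F_def T_def)
  have eq: "adjacent_pairs F + adjacent_pairs T + 2 * card (F \<inter> T) = 2 * max_edges (card F + card T)"
    using adjacent_pairs_split[OF A(1)] A(2) card by (simp add: F_def T_def)
  note bounds = adjacent_pairs_le[OF sub(1)] adjacent_pairs_le[OF sub(2)]
    max_edges_superadd[of "card F" "card T"]
  show "adjacent_pairs F = 2 * max_edges (card F)" "adjacent_pairs T = 2 * max_edges (card T)"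
    "max_edges (card A) = max_edges (card F) + max_edges (card T) + min (card F) (card T)"
    unfolding card using I eq bounds by linarith+
  have "card (F \<inter> T) = min (card F) (card T)"
    using I eq bounds by linarith
  then have "card (F \<inter> T) = card F \<or> card (F \<inter> T) = card T"
    by linarith
  then show "F \<subseteq> T \<or> T \<subseteq> F"
    using fin card_subset_eq[of F "F \<inter> T"] card_subset_eq[of T "F \<inter> T"] by blast
qed

text \<open>Write \<open>a = 2 ^ d + c\<close>. Since \<open>c + b\<close> is at most
  \<open>2 ^ d\<close>, splitting off \<open>2 ^ d\<close> and combining \<open>c\<close> with
  \<open>b\<close> exceeds the left side by at least \<open>min c b\<close>, which is
  positive.\<close>

lemma max_edges_strict_superadd:
  assumes "2 ^ d < a" "0 < b" "a + b \<le> 2 * 2 ^ d"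
  shows "max_edges a + max_edges b + min a b < max_edges (a + b)"
proof -
  obtain c where a: "a = 2 ^ d + c" "c > 0"
    using assms(1) less_imp_add_positive by blast
  have "max_edges (2 ^ d + (c + b)) = max_edges (2 ^ d) + max_edges (c + b) + (c + b)"
    and "max_edges (2 ^ d + c) = max_edges (2 ^ d) + max_edges c + c"
    using assms a by (intro max_edges_power2_add; simp)+
  then show ?thesis
    using a assms max_edges_superadd[of c b] by (simp add: add.assoc)
qed

text \<open>If both halves of an optimal set are nonempty, strict superadditivity past a power of two forces
  the larger half to have at most half the points of its subcube. By induction it lies in a face, and
  the smaller half is contained in it.\<close>

lemma optimal_in_face:
  assumes "A \<subseteq> cube (Suc n)" "adjacent_pairs A = 2 * max_edges (card A)" "card A \<le> 2 ^ n"
  shows "\<exists>i c. i < Suc n \<and> (\<forall>x\<in>A. x ! i = c)"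
  using assms
proof (induction n arbitrary: A)
  case 0
  then have "finite A" using finite_subset_cube by blast
  then have "\<forall>x\<in>A. \<forall>y\<in>A. x = y"
    using 0 card_le_Suc0_iff_eq by (metis One_nat_def power_0)
  then show ?case by (metis lessI)
next
  case (Suc n)
  define F T where "F = face_section False A" and "T = face_section True A"
  note opt = optimal_section[OF Suc.prems(1,2), folded F_def T_def]
  have sub: "F \<subseteq> cube (Suc n)" "T \<subseteq> cube (Suc n)"
    using face_section_subset[OF Suc.prems(1)] by (auto simp: F_def T_def)
  have card: "card A = card F + card T"
    using card_face_section[OF Suc.prems(1)] by (simp add: F_def T_def)
  have A: "A = Cons False ` F \<union> Cons True ` T"
    using face_section_Un[OF Suc.prems(1)] by (simp add: F_def T_def)
  consider "F = {}" | "T = {}" | "F \<noteq> {}" "T \<noteq> {}" by blast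
  then show ?case
  proof cases
    case 3
    then have pos: "card F > 0" "card T > 0"
      using sub finite_subset_cube card_gt_0_iff by blast+
    have small: "card F \<le> 2 ^ n" "card T \<le> 2 ^ n"
    proof -
      show "card F \<le> 2 ^ n"
        using max_edges_strict_superadd[of n "card F" "card T"] opt(3) pos Suc.prems(3) card
        by fastforce
      show "card T \<le> 2 ^ n"
        using max_edges_strict_superadd[of n "card T" "card F"] opt(3) pos Suc.prems(3) card
        by (fastforce simp: add.commute min.commute)
    qed
    obtain i c where i: "i < Suc n" "\<forall>x\<in>F \<union> T. x ! i = c"
    proof (cases "F \<subseteq> T")
      case True
      then show thesis
        using that Suc.IH[OF sub(2) opt(2) small(2)] by blast
    next
      case False
      then show thesis
        using that Suc.IH[OF sub(1) opt(1) small(1)] opt(4) by blast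
    qed
    then have "\<forall>x\<in>A. x ! Suc i = c"
      unfolding A by auto
    with i(1) show ?thesis by (metis Suc_less_eq)
  \<comment> \<open>If a section is empty, the first coordinate is constant on \<open>A\<close>;
    index 0 settles both remaining cases.\<close>
  qed (use A in \<open>auto intro!: exI[of _ 0]\<close>)
qed

section \<open>Isometries, complements and regularity of the cube\<close>

lemma isometric_refl: "A \<subseteq> cube n \<Longrightarrow> isometric n A A"
  unfolding isometric_def by (intro conjI exI[of _ id]) (auto simp: isometry_def)

lemma isometric_compl:
  assumes "isometric n A B"
  shows "isometric n (cube n - A) (cube n - B)"
proof -
  obtain \<phi> where \<phi>: "isometry n \<phi>" and A: "A \<subseteq> cube n" and B: "B = \<phi> ` A"
    using assms by (auto simp: isometric_def)
  have "\<phi> ` (cube n - A) = cube n - B"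
    using inj_on_image_set_diff[OF isometry_inj[OF \<phi>], of "cube n" A] isometry_surj[OF \<phi>] A B by auto
  then show ?thesis
    using \<phi> by (auto simp: isometric_def)
qed

lemma isometric_adjacent_pairs: "isometric n A B \<Longrightarrow> adjacent_pairs B = adjacent_pairs A"
  unfolding adjacent_pairs_def by (rule isometric_sum_pair)

text \<open>One isometry of the subcube has to match both sections at once. It then acts on the
  tails while the heads stay fixed.\<close>

lemma isometric_Suc:
  assumes "isometry n \<phi>" "A \<subseteq> cube (Suc n)" "B \<subseteq> cube (Suc n)"
    and "\<And>b. \<phi> ` face_section b A = face_section b B"
  shows "isometric (Suc n) A B"
proof -
  have "(\<lambda>x. hd x # \<phi> (tl x)) ` A =
      Cons False ` \<phi> ` face_section False A \<union> Cons True ` \<phi> ` face_section True A"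
    by (subst face_section_Un[OF assms(2)]) (simp add: image_Un image_image)
  also have "\<dots> = B"
    by (simp add: assms(4) flip: face_section_Un[OF assms(3)])
  finally show ?thesis
    using isometry_lift[OF assms(1)] assms(2) by (auto simp: isometric_def)
qed

text \<open>Regularity of the cube: one neighbour differs in the first coordinate, the others share
  it and are counted by induction.\<close>

lemma sum_adjacent_cube: "x \<in> cube n \<Longrightarrow> (\<Sum>y\<in>cube n. of_bool (hdist x y = 1)) = (n::nat)"
proof (induction n arbitrary: x)
  case (Suc n)
  then obtain b z where x: "x = b # z" "z \<in> cube n"
    by (elim cube_SucE)
  have "(\<Sum>y\<in>cube n. of_bool (hdist z y = 0)) = (1::nat)"
    using sum_hdist_eq_0[of "{z}" n "cube n"] x by simp
  moreover have "face_section c (cube (Suc n)) = cube n" for c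
    by (auto simp: face_section_def)
  ultimately show ?case
    using Suc.IH[OF x(2)] unfolding x sum_face_section[OF order_refl]
    by (cases b) simp_all
qed simp

text \<open>Counting degrees shows that \<open>A\<close> and its complement have the same edge
  boundary. The additive form avoids subtraction of naturals.\<close>

lemma adjacent_pairs_compl:
  assumes "A \<subseteq> cube n"
  shows "adjacent_pairs (cube n - A) + n * card A = adjacent_pairs A + n * card (cube n - A)"
proof -
  let ?C = "cube n - A"
  have fin: "finite A" using assms finite_subset_cube by blast
  define cross where "cross = (\<Sum>x\<in>A. \<Sum>y\<in>?C. of_bool (hdist x y = 1) :: nat)"
  have deg: "(\<Sum>y\<in>A. of_bool (hdist x y = 1)) + (\<Sum>y\<in>?C. of_bool (hdist x y = 1)) = n" if "x \<in> cube n" for x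
    using sum_adjacent_cube[OF that] sum.subset_diff[OF assms finite_cube, of "\<lambda>y. of_bool (hdist x y = 1) :: nat"]
    by simp
  have "n * card A = (\<Sum>x\<in>A. (\<Sum>y\<in>A. of_bool (hdist x y = 1)) + (\<Sum>y\<in>?C. of_bool (hdist x y = 1)))"
    using deg assms by (simp add: subset_iff)
  then have 1: "n * card A = adjacent_pairs A + cross"
    by (simp add: sum.distrib cross_def adjacent_pairs_def)
  have "n * card ?C = (\<Sum>x\<in>?C. (\<Sum>y\<in>A. of_bool (hdist x y = 1)) + (\<Sum>y\<in>?C. of_bool (hdist x y = 1)))"
    using deg by simp
  also have "\<dots> = (\<Sum>x\<in>?C. \<Sum>y\<in>A. of_bool (hdist x y = 1)) + adjacent_pairs ?C"
    by (simp add: sum.distrib adjacent_pairs_def)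
  also have "(\<Sum>x\<in>?C. \<Sum>y\<in>A. of_bool (hdist x y = 1)) = cross"
    unfolding cross_def by (subst sum.swap) (simp add: hdist_sym)
  finally show ?thesis using 1 by simp
qed

section \<open>Initial segments of the lexicographic order\<close>

definition lex_set :: "nat \<Rightarrow> nat \<Rightarrow> bool list set" where
  "lex_set n k = {x \<in> cube n. lex_index x < k}"

lemma lex_set_subset: "lex_set n k \<subseteq> cube n"
  by (auto simp: lex_set_def)

lemma lex_index_Nil [simp]: "lex_index [] = 0"
  by (simp add: lex_index_def)

lemma lex_index_Cons [simp]:
  "lex_index (b # x) = (if b then 2 ^ length x else 0) + lex_index x"
  unfolding lex_index_def by (simp add: sum.lessThan_Suc_shift del: sum.lessThan_Suc) (rule sum.cong, auto)

lemma lex_index_less: "lex_index x < 2 ^ length x"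
  by (induction x) auto

lemma lex_set_full: "2 ^ n \<le> k \<Longrightarrow> lex_set n k = cube n"
  unfolding lex_set_def cube_def using lex_index_less order_less_le_trans by blast

text \<open>The first coordinate is the most significant bit, so the upper half begins at position
  \<open>2 ^ n\<close>. Truncated subtraction gives the empty section if \<open>k\<close> is at most
  \<open>2 ^ n\<close>.\<close>

lemma face_section_lex_set:
  "face_section b (lex_set (Suc n) k) = lex_set n (if b then k - 2 ^ n else k)"
  by (auto simp: face_section_def lex_set_def cube_def)

lemma lex_set_0 [simp]: "lex_set n 0 = {}"
  by (simp add: lex_set_def)

text \<open>A segment either stays in the lower half or fills it and continues as a segment of the
  upper half. In the second case the edge count follows \<open>max_edges_power2_add\<close>.\<close>

lemma lex_set_optimal:
  "k \<le> 2 ^ n \<Longrightarrow> card (lex_set n k) = k \<and> adjacent_pairs (lex_set n k) = 2 * max_edges k"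
proof (induction n arbitrary: k)
  case 0
  then have "k = 0 \<or> k = 1" by auto
  moreover have "lex_set 0 (Suc 0) = {[]}"
    by (simp add: lex_set_full)
  ultimately show ?case
    by (elim disjE) (simp_all add: adjacent_pairs_def)
next
  case (Suc n)
  note split = card_face_section[OF lex_set_subset] adjacent_pairs_split[OF lex_set_subset]
    face_section_lex_set
  show ?case
  proof (cases "k \<le> 2 ^ n")
    case True
    then show ?thesis
      using Suc.IH[of k] by (simp add: split) (simp add: adjacent_pairs_def)
  next
    case False
    then obtain j where j: "k = 2 ^ n + j" "j \<le> 2 ^ n"
      using Suc.prems le_Suc_ex[of "2 ^ n" k] by auto
    have F: "lex_set n k = lex_set n (2 ^ n)"
      using j by (simp add: lex_set_full)
    have "lex_set n (2 ^ n) \<inter> lex_set n j = lex_set n j"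
      using lex_set_subset by (auto simp: lex_set_full)
    then show ?thesis
      using Suc.IH[of "2 ^ n"] Suc.IH[OF j(2)] max_edges_power2_add[OF j(2)] F
      by (simp add: split j(1))
  qed
qed

text \<open>Uniqueness of optimal sets. A set with at most half of the points is moved into the face
  with head \<open>False\<close>. For a larger one the complement, optimal as well, is moved into
  the face with head \<open>True\<close>, so that the lower half becomes full. Induction treats the
  remaining section.\<close>

lemma optimal_isometric_lex_set:
  assumes "A \<subseteq> cube n" "adjacent_pairs A = 2 * max_edges (card A)"
  shows "isometric n A (lex_set n (card A))"
  using assms
proof (induction n arbitrary: A)
  case 0
  then have "A = {} \<or> A = {[]}" by auto
  moreover have "lex_set 0 (Suc 0) = {[]}"
    by (simp add: lex_set_full)
  ultimately show ?case
    by (elim disjE) (simp_all add: isometric_refl)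
next
  case (Suc n)
  text \<open>It suffices to move \<open>A\<close> to a set one of whose two sections is empty or full.\<close>
  have main: "isometric (Suc n) A (lex_set (Suc n) (card A))"
    if B: "isometric (Suc n) A B"
      and b: "\<And>\<phi>. isometry n \<phi> \<Longrightarrow>
        \<phi> ` face_section b B = face_section b (lex_set (Suc n) (card A))"
      and card: "card (face_section (\<not> b) B) = (if b then card A else card A - 2 ^ n)" for B b
  proof -
    have sub: "B \<subseteq> cube (Suc n)"
      using isometric_subset[OF B] .
    have "adjacent_pairs B = 2 * max_edges (card B)"
      using Suc.prems isometric_adjacent_pairs[OF B] isometric_card[OF B] by simp
    from optimal_section(1,2)[OF sub this]
    have "isometric n (face_section (\<not> b) B) (lex_set n (card (face_section (\<not> b) B)))"
      using Suc.IH[OF face_section_subset[OF sub], of "\<not> b"] by (cases b) auto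
    then obtain \<phi> where \<phi>: "isometry n \<phi>"
      "\<phi> ` face_section (\<not> b) B = face_section (\<not> b) (lex_set (Suc n) (card A))"
      by (auto simp: isometric_def face_section_lex_set card split: if_splits)
    \<comment> \<open>The section at \<open>b\<close> is matched by every isometry, so the one found
      for the other section serves both.\<close>
    have "\<phi> ` face_section b' B = face_section b' (lex_set (Suc n) (card A))" for b'
      using \<phi> b[OF \<phi>(1)] by (cases "b' = b") auto
    then show ?thesis
      using isometric_trans[OF B isometric_Suc[OF \<phi>(1) sub lex_set_subset]] by blast
  qed
  show ?case
  proof (cases "card A \<le> 2 ^ n")
    case True
    obtain i c where "i < Suc n" "\<forall>x\<in>A. x ! i = c"
      using optimal_in_face[OF Suc.prems True] by blast
    then obtain B where B: "isometric (Suc n) A B" "\<forall>x\<in>B. hd x = False"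
      using isometric_face_head[OF Suc.prems(1)] by metis
    then have T: "face_section True B = {}"
      by (force simp: face_section_def)
    show ?thesis
    proof (rule main[OF B(1), of True])
      show "card (face_section (\<not> True) B) = (if True then card A else card A - 2 ^ n)"
        using card_face_section[OF isometric_subset[OF B(1)]] isometric_card[OF B(1)] T by simp
    qed (use T True in \<open>simp add: face_section_lex_set\<close>)
  next
    case False
    define C where "C = cube (Suc n) - A"
    have fin: "finite A" using Suc.prems finite_subset_cube by blast
    have cardC: "card C = 2 ^ Suc n - card A"
      using Suc.prems(1) fin by (simp add: C_def card_Diff_subset)
    have cardA: "card A \<le> 2 ^ Suc n"
      using card_mono[OF finite_cube Suc.prems(1)] by simp
    \<comment> \<open>A competitor for \<open>C\<close>: the complement of \<open>L\<close> has as
      many points as \<open>A\<close>, hence at most as many edges. Complementing this comparison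
      shows that \<open>C\<close> is optimal.\<close>
    define L where "L = lex_set (Suc n) (card C)"
    have L: "L \<subseteq> cube (Suc n)" "card L = card C" "adjacent_pairs L = 2 * max_edges (card C)"
      using lex_set_optimal[of "card C" "Suc n"] lex_set_subset cardC by (auto simp: L_def)
    have finL: "finite L" using L finite_subset_cube by blast
    have cardL: "card (cube (Suc n) - L) = card A"
      using L finL cardC cardA by (simp add: card_Diff_subset)
    have "adjacent_pairs (cube (Suc n) - L) \<le> adjacent_pairs A"
      using adjacent_pairs_le[of "cube (Suc n) - L"] Suc.prems(2) cardL by auto
    then have "adjacent_pairs L \<le> adjacent_pairs C"
      using adjacent_pairs_compl[OF L(1)] adjacent_pairs_compl[OF Suc.prems(1)] cardL L(2)
      unfolding C_def[symmetric] by simp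
    then have optC: "adjacent_pairs C = 2 * max_edges (card C)"
      using adjacent_pairs_le[of C "Suc n"] L(3) by (auto simp: C_def)
    have C: "C \<subseteq> cube (Suc n)" "card C \<le> 2 ^ n"
      using False cardC by (auto simp: C_def)
    obtain i c where "i < Suc n" "\<forall>x\<in>C. x ! i = c"
      using optimal_in_face[OF C(1) optC C(2)] by blast
    then obtain B where B: "isometric (Suc n) C B" "\<forall>x\<in>B. hd x = True"
      using isometric_face_head[OF C(1)] by metis
    define B' where "B' = cube (Suc n) - B"
    have B': "isometric (Suc n) A B'"
      using isometric_compl[OF B(1)] Suc.prems(1) by (simp add: B'_def C_def double_diff)
    have F: "face_section False B' = cube n"
      using B(2) by (auto simp: B'_def face_section_def)
    show ?thesis
    proof (rule main[OF B', of False])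
      show "card (face_section (\<not> False) B') = (if False then card A else card A - 2 ^ n)"
        using card_face_section[OF isometric_subset[OF B']] isometric_card[OF B'] F by simp
    \<comment> \<open>The lower section is the whole subcube, which every isometry maps onto
      itself.\<close>
    qed (use F False in \<open>simp add: face_section_lex_set lex_set_full isometry_surj\<close>)
  qed
qed

section \<open>The noise operator on indicator functions\<close>

definition support :: "nat \<Rightarrow> (bool list \<Rightarrow> bool) \<Rightarrow> bool list set" where
  "support n f = {x \<in> cube n. f x}"

text \<open>The noise operator applied to the indicator of \<open>A\<close>, with the Bernoulli
  weights expressed by Hamming distance. Invariance under isometries can be read off this
  form.\<close>

definition noise :: "nat \<Rightarrow> real \<Rightarrow> bool list set \<Rightarrow> bool list \<Rightarrow> real" where
  "noise n eps A x = (\<Sum>y\<in>A. eps ^ hdist x y * (1 - eps) ^ (n - hdist x y))"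

definition moment :: "nat \<Rightarrow> real \<Rightarrow> real \<Rightarrow> bool list set \<Rightarrow> real" where
  "moment n alpha eps A = expect n (\<lambda>x. noise n eps A x powr alpha)"

lemma support_subset: "support n f \<subseteq> cube n"
  by (auto simp: support_def)

lemma xorv_Cons [simp]: "xorv (a # x) (b # y) = (a \<noteq> b) # xorv x y"
  by (simp add: xorv_def)

lemma length_xorv [simp]: "length (xorv x y) = min (length x) (length y)"
  by (simp add: xorv_def)

lemma xorv_xorv: "length x = length y \<Longrightarrow> xorv x (xorv x y) = y"
  by (induction x y rule: list_induct2) (auto simp: xorv_def)

lemma noise_prob_xorv:
  "length x = length y \<Longrightarrow>
    noise_prob eps (xorv x y) = eps ^ hdist x y * (1 - eps) ^ (length x - hdist x y)"
proof (induction x y rule: list_induct2)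
  case (Cons a x b y)
  have "noise_prob eps ((a \<noteq> b) # xorv x y) = (if a \<noteq> b then eps else 1 - eps) * noise_prob eps (xorv x y)"
    unfolding noise_prob_def by (simp add: prod.lessThan_Suc_shift del: prod.lessThan_Suc)
  then show ?case
    using Cons hdist_le[of x y] by (auto simp: Suc_diff_le)
qed (simp add: noise_prob_def xorv_def)

lemma sum_support: "(\<Sum>x\<in>cube n. g x * of_bool (f x)) = (\<Sum>x\<in>support n f. g x :: real)"
  unfolding support_def sum.inter_filter[OF finite_cube] by (intro sum.cong refl) simp

lemma noise_op_eq:
  assumes "x \<in> cube n"
  shows "noise_op n eps f x = noise n eps (support n f) x"
proof -
  \<comment> \<open>Adding \<open>x\<close> is an involution of the cube, which turns the sum over
    noise vectors into a sum over targets.\<close>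
  have "noise_op n eps f x = (\<Sum>y\<in>cube n. noise_prob eps (xorv x y) * of_bool (f y))"
    unfolding noise_op_def using assms
    by (intro sum.reindex_bij_witness[of _ "xorv x" "xorv x"])
       (auto simp: xorv_xorv cube_def)
  also have "\<dots> = noise n eps (support n f) x"
    unfolding sum_support noise_def using assms
    by (intro sum.cong refl) (auto simp: support_def noise_prob_xorv cube_def)
  finally show ?thesis .
qed

lemma Mfun_eq: "Mfun n alpha eps f = moment n alpha eps (support n f)"
  unfolding Mfun_def moment_def expect_def by (simp add: noise_op_eq)

lemma bmean_eq: "bmean n f = card (support n f) / 2 ^ n"
  using sum_support[of "\<lambda>_. 1" f n] by (simp add: bmean_def expect_def)

text \<open>The kernel depends only on the distance, and an isometry permutes the cube. Hence
  isometric sets tie at every noise level.\<close>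

lemma isometric_moment:
  assumes "isometric n A B"
  shows "moment n alpha eps B = moment n alpha eps A"
proof -
  obtain \<phi> where \<phi>: "isometry n \<phi>" and A: "A \<subseteq> cube n" and B: "B = \<phi> ` A"
    using assms by (auto simp: isometric_def)
  have inj: "inj_on \<phi> A"
    using A \<phi> inj_on_subset isometry_inj by blast
  have noise: "noise n eps B (\<phi> x) = noise n eps A x" if "x \<in> cube n" for x
    unfolding noise_def B sum.reindex[OF inj] o_def using A \<phi> that
    by (intro sum.cong refl) (auto simp: isometry_def subset_iff)
  have "(\<Sum>x\<in>\<phi> ` cube n. noise n eps B x powr alpha) = (\<Sum>x\<in>cube n. noise n eps A x powr alpha)"
    by (simp add: sum.reindex[OF isometry_inj[OF \<phi>]] noise)
  then show ?thesis
    by (simp add: moment_def expect_def isometry_surj[OF \<phi>])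
qed

section \<open>Small noise\<close>

text \<open>At noise 0 the kernel has slope \<open>- n\<close> at distance 0, slope 1 at distance 1,
  and slope 0 beyond.\<close>

lemma DERIV_noise_0:
  assumes "x \<in> cube n" "A \<subseteq> cube n"
  shows "((\<lambda>e. noise n e A x) has_real_derivative
    real (\<Sum>y\<in>A. of_bool (hdist x y = 1)) - real n * of_bool (x \<in> A)) (at 0)"
proof -
  have fin: "finite A" using assms(2) finite_subset_cube by blast
  have deriv: "((\<lambda>e::real. e ^ h * (1 - e) ^ k) has_real_derivative of_bool (h = 1) - real k * of_bool (h = 0)) (at 0)"
    for h k :: nat
    by (rule derivative_eq_intros refl | simp)+ (cases h; auto simp: power_0_left)
  have "((\<lambda>e. noise n e A x) has_real_derivative
    (\<Sum>y\<in>A. of_bool (hdist x y = 1) - real (n - hdist x y) * of_bool (hdist x y = 0))) (at 0)"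
    unfolding noise_def by (intro DERIV_sum deriv)
  also have "(\<Sum>y\<in>A. of_bool (hdist x y = 1) - real (n - hdist x y) * of_bool (hdist x y = 0))
      = (\<Sum>y\<in>A. of_bool (hdist x y = 1) - (if x = y then real n else 0))"
    using assms by (intro sum.cong refl) (auto simp: hdist_0_cube[of _ n] subset_iff)
  also have "\<dots> = real (\<Sum>y\<in>A. of_bool (hdist x y = 1)) - real n * of_bool (x \<in> A)"
    using fin by (simp add: sum_subtractf)
  finally show ?thesis .
qed

lemma noise_at_0:
  assumes "x \<in> cube n" "A \<subseteq> cube n"
  shows "noise n 0 A x = of_bool (x \<in> A)"
proof -
  have fin: "finite A" using assms(2) finite_subset_cube by blast
  have "noise n 0 A x = (\<Sum>y\<in>A. if x = y then 1 else 0)"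
    unfolding noise_def using assms
    by (intro sum.cong refl) (auto simp: power_0_left hdist_0_cube[of _ n] subset_iff)
  then show ?thesis
    using fin by simp
qed

lemma noise_nonneg: "0 \<le> e \<Longrightarrow> e \<le> 1 \<Longrightarrow> 0 \<le> noise n e A x"
  unfolding noise_def by (intro sum_nonneg) simp

text \<open>At a point of \<open>A\<close> the noise starts at 1 and the chain rule applies.
  Elsewhere it starts at 0, where the rule for powers asks for a positive base, so a direct bound of
  order \<open>e powr alpha\<close> takes its place.\<close>

lemma noise_powr_small:
  assumes "x \<in> cube n" "A \<subseteq> cube n" "alpha > 1"
  shows "((\<lambda>e. (noise n e A x powr alpha - of_bool (x \<in> A)) / e) \<longlongrightarrow>
    alpha * (of_bool (x \<in> A) * (real (\<Sum>y\<in>A. of_bool (hdist x y = 1)) - real n))) (at_right 0)"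
proof (cases "x \<in> A")
  case True
  then have 1: "noise n 0 A x = 1"
    by (simp add: noise_at_0[OF assms(1,2)])
  have "((\<lambda>e. noise n e A x powr alpha) has_real_derivative
      alpha * noise n 0 A x powr (alpha - of_nat 1) * (real (\<Sum>y\<in>A. of_bool (hdist x y = 1)) - real n * of_bool (x \<in> A))) (at 0)"
    by (rule DERIV_fun_powr[OF DERIV_noise_0[OF assms(1,2)]]) (simp add: 1)
  then have "((\<lambda>e. (noise n e A x powr alpha - 1) / e) \<longlongrightarrow>
      alpha * (real (\<Sum>y\<in>A. of_bool (hdist x y = 1)) - real n)) (at 0)"
    using True by (simp add: has_field_derivative_iff 1)
  then show ?thesis
    using True by (auto intro: filterlim_mono[OF _ order_refl at_le])
next
  case False
  have fin: "finite A" using assms(2) finite_subset_cube by blast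
  \<comment> \<open>Each point of \<open>A\<close> is at distance at least 1 from \<open>x\<close>,
    so every kernel value carries a factor \<open>e\<close>.\<close>
  have bound: "noise n e A x \<le> card A * e" if e: "0 < e" "e < 1" for e :: real
  proof -
    have "e ^ hdist x y * (1 - e) ^ (n - hdist x y) \<le> e" if y: "y \<in> A" for y
    proof -
      have "hdist x y \<noteq> 0"
        using False assms hdist_0_cube[of x n y] y by blast
      then have "e ^ hdist x y \<le> e ^ 1"
        using e by (intro power_decreasing) auto
      moreover have "(1 - e) ^ (n - hdist x y) \<le> 1"
        using e by (intro power_le_one) auto
      ultimately have "e ^ hdist x y * (1 - e) ^ (n - hdist x y) \<le> e ^ 1 * 1"
        using e by (intro mult_mono) auto
      then show ?thesis by simp
    qed
    then show ?thesis
      unfolding noise_def using sum_bounded_above[of A _ e] by force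
  qed
  \<comment> \<open>After division by \<open>e\<close> the bound has the exponent
    \<open>alpha - 1\<close>, which is positive.\<close>
  have "((\<lambda>e. card A powr alpha * e powr (alpha - 1)) \<longlongrightarrow> card A powr alpha * 0) (at_right 0)"
    by (intro tendsto_mult tendsto_const tendsto_zero_powrI[where b = "alpha - 1"])
      (use assms(3) in \<open>auto intro!: tendsto_ident_at simp: eventually_mono[OF eventually_at_right_less]\<close>)
  then have lim: "((\<lambda>e. card A powr alpha * e powr (alpha - 1)) \<longlongrightarrow> 0) (at_right 0)"
    by simp
  have ev: "\<forall>\<^sub>F e in at_right 0. 0 < e \<and> e < (1::real)"
    by (simp add: eventually_at_right_field exI[of _ 1])
  have le: "\<forall>\<^sub>F e in at_right 0. norm (noise n e A x powr alpha / e) \<le> card A powr alpha * e powr (alpha - 1)"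
    using ev
  proof eventually_elim
    case (elim e)
    have "noise n e A x powr alpha \<le> (real (card A) * e) powr alpha"
      using bound[of e] elim noise_nonneg[of e] assms(3) by (intro powr_mono2) auto
    also have "\<dots> = card A powr alpha * e powr (alpha - 1) * e"
      using elim powr_mult_base[of e "alpha - 1"] by (simp add: powr_mult mult.assoc mult.commute[of _ e])
    finally show ?case
      using elim by (simp add: divide_le_eq)
  qed
  have "((\<lambda>e. noise n e A x powr alpha / e) \<longlongrightarrow> 0) (at_right 0)"
    by (rule tendsto_0_le[OF lim, of _ 1]) (use le in eventually_elim, simp)
  then show ?thesis
    using False by simp
qed

lemma sum_of_bool_subset:
  "A \<subseteq> cube n \<Longrightarrow> (\<Sum>x\<in>cube n. of_bool (x \<in> A) * g x) = (\<Sum>x\<in>A. g x :: real)"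
  using sum.inter_restrict[OF finite_cube, of g n A] by (simp add: inf.absorb2 of_bool_def if_distrib if_distribR cong: if_cong)

text \<open>The coefficient of the first-order term is \<open>- alpha\<close> times the edge boundary.\<close>

lemma moment_small:
  assumes "A \<subseteq> cube n" "alpha > 1"
  shows "((\<lambda>e. (moment n alpha e A - card A / 2 ^ n) / e) \<longlongrightarrow>
    alpha * (real (adjacent_pairs A) - n * card A) / 2 ^ n) (at_right 0)"
proof -
  have "((\<lambda>e. (\<Sum>x\<in>cube n. (noise n e A x powr alpha - of_bool (x \<in> A)) / e) / 2 ^ n) \<longlongrightarrow>
    (\<Sum>x\<in>cube n. alpha * (of_bool (x \<in> A) * (real (\<Sum>y\<in>A. of_bool (hdist x y = 1)) - real n))) / 2 ^ n) (at_right 0)"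
    using assms by (intro tendsto_intros noise_powr_small) auto
  moreover have "(\<Sum>x\<in>cube n. alpha * (of_bool (x \<in> A) * (real (\<Sum>y\<in>A. of_bool (hdist x y = 1)) - real n)))
     = alpha * (real (adjacent_pairs A) - n * card A)"
    unfolding sum_distrib_left[symmetric] sum_of_bool_subset[OF assms(1)] adjacent_pairs_def
    by (simp add: sum_subtractf)
  moreover have "(\<Sum>x\<in>cube n. (noise n e A x powr alpha - of_bool (x \<in> A)) / e) / 2 ^ n
      = (moment n alpha e A - card A / 2 ^ n) / e" for e
    using sum_of_bool_subset[OF assms(1), of "\<lambda>_. 1"]
    by (simp add: moment_def expect_def sum_subtractf diff_divide_distrib mult.commute flip: sum_divide_distrib)
  ultimately show ?thesis by simp
qed

lemma eventually_less_if_tendsto_less: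
  fixes a b :: real
  assumes "(f \<longlongrightarrow> a) F" "(g \<longlongrightarrow> b) F" "a < b"
  shows "\<forall>\<^sub>F x in F. f x < g x"
proof -
  obtain c where "a < c" "c < b" using assms(3) dense by blast
  then have "\<forall>\<^sub>F x in F. f x < c" "\<forall>\<^sub>F x in F. c < g x"
    using assms(1,2) order_tendstoD by blast+
  then show ?thesis by eventually_elim simp
qed

text \<open>Equal sizes make the constant terms and the degree terms agree, so the edge counts
  decide.\<close>

lemma moment_small_less:
  assumes "A \<subseteq> cube n" "B \<subseteq> cube n" "card A = card B" "adjacent_pairs A < adjacent_pairs B" "alpha > 1"
  shows "\<forall>\<^sub>F e in at_right 0. moment n alpha e A < moment n alpha e B"
proof -
  have "alpha * (real (adjacent_pairs A) - n * card A) / 2 ^ n < alpha * (real (adjacent_pairs B) - n * card B) / 2 ^ n"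
    using assms(3-5) by (simp add: divide_strict_right_mono)
  from eventually_less_if_tendsto_less[OF moment_small[OF assms(1,5)] moment_small[OF assms(2,5)] this]
  have "\<forall>\<^sub>F e in at_right 0. (moment n alpha e A - card A / 2 ^ n) / e < (moment n alpha e B - card B / 2 ^ n) / e" .
  moreover have "\<forall>\<^sub>F e in at_right 0. (0::real) < e"
    by (rule eventually_at_right_less)
  ultimately show ?thesis
    by eventually_elim (simp add: assms(3) divide_less_cancel)
qed

text \<open>There are finitely many competitors, so one threshold serves them all. A set that is not
  optimal loses strictly at first order; an optimal one is isometric to the segment and ties
  exactly.\<close>

lemma lex_set_maximal_small_noise:
  assumes "k \<le> 2 ^ n" "alpha > 1"
  shows "\<forall>\<^sub>F e in at_right 0. \<forall>A\<in>{A. A \<subseteq> cube n \<and> card A = k}. moment n alpha e A \<le> moment n alpha e (lex_set n k)"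
proof (rule eventually_ball_finite)
  show "\<forall>A\<in>{A. A \<subseteq> cube n \<and> card A = k}. \<forall>\<^sub>F e in at_right 0. moment n alpha e A \<le> moment n alpha e (lex_set n k)"
  proof clarify
    fix A assume A: "A \<subseteq> cube n" "k = card A"
    note lex = lex_set_optimal[OF assms(1)]
    show "\<forall>\<^sub>F e in at_right 0. moment n alpha e A \<le> moment n alpha e (lex_set n (card A))"
    proof (cases "adjacent_pairs A = 2 * max_edges (card A)")
      case True
      then show ?thesis
        using isometric_moment[OF optimal_isometric_lex_set[OF A(1) True]] by simp
    next
      case False
      then have "adjacent_pairs A < adjacent_pairs (lex_set n k)"
        using adjacent_pairs_le[OF A(1)] lex A(2) by simp
      then have "\<forall>\<^sub>F e in at_right 0. moment n alpha e A < moment n alpha e (lex_set n k)"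
        using A lex lex_set_subset assms(2) by (intro moment_small_less) auto
      then show ?thesis
        unfolding A(2) by eventually_elim simp
    qed
  qed
qed simp

section \<open>Degree-one weight\<close>

text \<open>The Walsh character of a single coordinate, counted from 0.\<close>

definition sgn_coord :: "nat \<Rightarrow> bool list \<Rightarrow> real" where
  "sgn_coord i x = (if x ! i then -1 else 1)"

definition deg1_coeff :: "nat \<Rightarrow> bool list set \<Rightarrow> nat \<Rightarrow> real" where
  "deg1_coeff n A i = (\<Sum>y\<in>A. sgn_coord i y) / 2 ^ n"

definition deg1_part :: "nat \<Rightarrow> bool list set \<Rightarrow> bool list \<Rightarrow> real" where
  "deg1_part n A x = (\<Sum>i<n. deg1_coeff n A i * sgn_coord i x)"

definition deg1_weight :: "nat \<Rightarrow> bool list set \<Rightarrow> real" where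
  "deg1_weight n A = (\<Sum>i<n. (deg1_coeff n A i)\<^sup>2)"

lemma sgn_coord_mult_self [simp]: "sgn_coord i x * sgn_coord i x = 1"
  by (simp add: sgn_coord_def)

lemma W1_eq: "W1 n f = deg1_weight n (support n f)"
proof -
  have "fourier1 n f i = deg1_coeff n (support n f) i" for i
    unfolding fourier1_def expect_def deg1_coeff_def sgn_coord_def sum_support[symmetric]
    by (simp add: mult.commute)
  then show ?thesis
    by (simp add: W1_def deg1_weight_def)
qed

definition flip :: "nat \<Rightarrow> bool list \<Rightarrow> bool list" where
  "flip i x = x[i := \<not> x ! i]"

lemma flip_cube [simp]: "flip i x \<in> cube n \<longleftrightarrow> x \<in> cube n"
  by (simp add: flip_def cube_def)

lemma flip_flip [simp]: "flip i (flip i x) = x"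
  by (cases "i < length x") (simp_all add: flip_def list_update_beyond)

lemma sgn_coord_flip:
  "x \<in> cube n \<Longrightarrow> i < n \<Longrightarrow> sgn_coord j (flip i x) = (if i = j then - sgn_coord j x else sgn_coord j x)"
  by (auto simp: sgn_coord_def flip_def cube_def)

text \<open>Flipping a coordinate permutes the cube, so the sum equals its own negative.
  Orthogonality of the characters follows.\<close>

lemma sum_cube_odd:
  fixes g :: "bool list \<Rightarrow> real"
  assumes "\<And>x. x \<in> cube n \<Longrightarrow> g (flip i x) = - g x"
  shows "(\<Sum>x\<in>cube n. g x) = 0"
proof -
  have "(\<Sum>x\<in>cube n. g x) = (\<Sum>x\<in>cube n. - g x)"
    by (rule sum.reindex_bij_witness[of _ "flip i" "flip i"]) (simp_all add: assms)
  then show ?thesis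
    by (simp add: sum_negf)
qed

lemma sum_sgn_coord: "i < n \<Longrightarrow> (\<Sum>x\<in>cube n. sgn_coord i x) = 0"
  by (rule sum_cube_odd[of _ _ i]) (simp add: sgn_coord_flip)

lemma sum_sgn_coord_mult:
  assumes "i < n"
  shows "(\<Sum>x\<in>cube n. sgn_coord i x * sgn_coord j x) = (if i = j then 2 ^ n else 0)"
proof (cases "i = j")
  case False
  then show ?thesis
    using assms by (auto intro!: sum_cube_odd[of _ _ i] simp: sgn_coord_flip)
qed simp

lemma sum_deg1_part_mult:
  "(\<Sum>x\<in>cube n. g x * deg1_part n A x) = (\<Sum>i<n. deg1_coeff n A i * (\<Sum>x\<in>cube n. g x * sgn_coord i x))"
  unfolding deg1_part_def sum_distrib_left
  by (subst sum.swap) (simp add: mult_ac)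

text \<open>Parseval at degree one, from the orthogonality of the single-coordinate
  characters.\<close>

lemma sum_deg1_part_square: "(\<Sum>x\<in>cube n. (deg1_part n A x)\<^sup>2) = 2 ^ n * deg1_weight n A"
proof -
  have inner: "(\<Sum>x\<in>cube n. deg1_part n A x * sgn_coord i x) = 2 ^ n * deg1_coeff n A i" if "i < n" for i
  proof -
    have "(\<Sum>x\<in>cube n. sgn_coord i x * deg1_part n A x) = (\<Sum>j<n. deg1_coeff n A j * (if i = j then 2 ^ n else 0))"
      unfolding sum_deg1_part_mult by (simp add: sum_sgn_coord_mult[OF that])
    also have "\<dots> = 2 ^ n * deg1_coeff n A i"
      using that by (simp add: if_distrib cong: if_cong)
    finally show ?thesis
      by (simp add: mult.commute)
  qed
  have "(\<Sum>x\<in>cube n. (deg1_part n A x)\<^sup>2) = (\<Sum>i<n. deg1_coeff n A i * (2 ^ n * deg1_coeff n A i))"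
    unfolding power2_eq_square sum_deg1_part_mult by (simp add: inner)
  then show ?thesis
    by (simp add: deg1_weight_def power2_eq_square sum_distrib_left mult_ac)
qed

text \<open>A coordinate contributes 1 where the points agree and -1 where they differ.\<close>

lemma sum_sgn_coord_mult_eq_hdist:
  "x \<in> cube n \<Longrightarrow> y \<in> cube n \<Longrightarrow> (\<Sum>i<n. sgn_coord i x * sgn_coord i y) = real n - 2 * real (hdist x y)"
proof (induction n arbitrary: x y)
  case (Suc n)
  obtain a u where x: "x = a # u" "u \<in> cube n" using Suc.prems by (elim cube_SucE)
  obtain b v where y: "y = b # v" "v \<in> cube n" using Suc.prems by (elim cube_SucE)
  have "(\<Sum>i<Suc n. sgn_coord i x * sgn_coord i y)
      = sgn_coord 0 x * sgn_coord 0 y + (\<Sum>i<n. sgn_coord i u * sgn_coord i v)"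
    by (simp add: sum.lessThan_Suc_shift sgn_coord_def x y del: sum.lessThan_Suc)
  then show ?case
    using Suc.IH[OF x(2) y(2)] by (auto simp: sgn_coord_def x y)
qed simp

text \<open>The bridge from characters to the kernel: its derivative at one half is proportional to
  this affine function of the distance.\<close>

lemma deg1_part_eq:
  assumes "x \<in> cube n" "A \<subseteq> cube n"
  shows "deg1_part n A x = (\<Sum>y\<in>A. real n - 2 * real (hdist x y)) / 2 ^ n"
proof -
  have "deg1_part n A x = (\<Sum>i<n. \<Sum>y\<in>A. sgn_coord i x * sgn_coord i y) / 2 ^ n"
    unfolding deg1_part_def deg1_coeff_def by (simp add: sum_divide_distrib sum_distrib_right sum_distrib_left mult_ac)
  also have "(\<Sum>i<n. \<Sum>y\<in>A. sgn_coord i x * sgn_coord i y) = (\<Sum>y\<in>A. \<Sum>i<n. sgn_coord i x * sgn_coord i y)"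
    by (rule sum.swap)
  also have "\<dots> = (\<Sum>y\<in>A. real n - 2 * real (hdist x y))"
    using assms by (intro sum.cong refl sum_sgn_coord_mult_eq_hdist) auto
  finally show ?thesis .
qed

section \<open>Noise close to one half\<close>

text \<open>Total mass one: the two values of the first coordinate contribute \<open>e\<close> and
  \<open>1 - e\<close> times the mass in one dimension less.\<close>

lemma sum_noise_kernel: "y \<in> cube n \<Longrightarrow> (\<Sum>x\<in>cube n. e ^ hdist x y * (1 - e) ^ (n - hdist x y)) = (1::real)"
proof (induction n arbitrary: y)
  case (Suc n)
  obtain b z where y: "y = b # z" "z \<in> cube n" using Suc.prems by (elim cube_SucE)
  have sec: "face_section c (cube (Suc n)) = cube n" for c
    by (auto simp: face_section_def)
  have same: "(\<Sum>x\<in>cube n. e ^ hdist x z * (1 - e) ^ (Suc n - hdist x z)) = 1 - e"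
  proof -
    have "(\<Sum>x\<in>cube n. e ^ hdist x z * (1 - e) ^ (Suc n - hdist x z))
        = (\<Sum>x\<in>cube n. (1 - e) * (e ^ hdist x z * (1 - e) ^ (n - hdist x z)))"
    proof (intro sum.cong refl)
      fix x assume "x \<in> cube n"
      then have "hdist x z \<le> n"
        using hdist_le[of x z] by (simp add: cube_def)
      then show "e ^ hdist x z * (1 - e) ^ (Suc n - hdist x z) = (1 - e) * (e ^ hdist x z * (1 - e) ^ (n - hdist x z))"
        by (simp add: Suc_diff_le)
    qed
    then show ?thesis
      using Suc.IH[OF y(2)] by (simp flip: sum_distrib_left)
  qed
  have other: "(\<Sum>x\<in>cube n. e * e ^ hdist x z * (1 - e) ^ (n - hdist x z)) = e"
    using Suc.IH[OF y(2)] by (simp add: mult.assoc flip: sum_distrib_left)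
  show ?case
    unfolding sum_face_section[OF order_refl] sec y(1)
    using same other by (cases b) simp_all
qed simp

lemma sum_noise:
  assumes "A \<subseteq> cube n"
  shows "(\<Sum>x\<in>cube n. noise n e A x) = card A"
proof -
  have "(\<Sum>x\<in>cube n. noise n e A x) = (\<Sum>y\<in>A. \<Sum>x\<in>cube n. e ^ hdist x y * (1 - e) ^ (n - hdist x y))"
    unfolding noise_def by (rule sum.swap)
  also have "\<dots> = (\<Sum>y\<in>A. 1)"
    using assms by (intro sum.cong refl sum_noise_kernel) auto
  finally show ?thesis by simp
qed

lemma noise_half:
  assumes "x \<in> cube n"
  shows "noise n (1 / 2) A x = card A / 2 ^ n"
proof -
  have "(1 / 2) ^ hdist x y * (1 - 1 / 2) ^ (n - hdist x y) = (1 / 2 :: real) ^ n" for y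
    using hdist_le[of x y] assms by (simp add: cube_def flip: power_add)
  then show ?thesis
    unfolding noise_def by (simp add: power_one_over)
qed

text \<open>At one half the kernel at distance \<open>h\<close> has slope
  \<open>- 2 (n - 2 h) / 2 ^ n\<close>, and \<open>deg1_part_eq\<close> identifies the sum of these
  slopes over \<open>A\<close>.\<close>

lemma DERIV_noise_half:
  assumes "x \<in> cube n" "A \<subseteq> cube n"
  shows "((\<lambda>e. noise n e A x) has_real_derivative - 2 * deg1_part n A x) (at (1 / 2))"
proof -
  have deriv: "((\<lambda>e::real. e ^ h * (1 - e) ^ (n - h)) has_real_derivative
      - 2 * ((real n - 2 * real h) / 2 ^ n)) (at (1 / 2))" if h: "h \<le> n" for h :: nat
  proof -
    have D: "((\<lambda>e::real. e ^ h * (1 - e) ^ (n - h)) has_real_derivative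
      (real h * (1 / 2) ^ (h - 1) * (1 / 2) ^ (n - h) - (1 / 2) ^ h * (real (n - h) * (1 / 2) ^ (n - h - 1)))) (at (1 / 2))"
      (is "(_ has_real_derivative ?D) _")
      by (rule derivative_eq_intros refl | simp)+
    \<comment> \<open>The truncated exponent \<open>h - 1\<close> is harmless, since the factor
      \<open>h\<close> vanishes at \<open>h = 0\<close>.\<close>
    have a: "real h * (1 / 2) ^ (h - 1) * (1 / 2) ^ (n - h) = 2 * real h * (1 / 2) ^ n"
    proof (cases h)
      case (Suc g)
      then have "(1 / 2) ^ (h - 1) * (1 / 2) ^ (n - h) = 2 * (1 / 2 :: real) ^ (h + (n - h))"
        by (simp add: power_add)
      then show ?thesis using h by simp
    qed simp
    have b: "(1 / 2) ^ h * (real (n - h) * (1 / 2) ^ (n - h - 1)) = 2 * real (n - h) * (1 / 2) ^ n"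
    proof (cases "n - h")
      case (Suc g)
      then have "(1 / 2) ^ h * (1 / 2) ^ (n - h - 1) = 2 * (1 / 2 :: real) ^ (h + (n - h))"
        by (simp add: power_add)
      then show ?thesis using h by (simp add: mult.left_commute[of "_ ^ h"])
    qed simp
    have "?D = - 2 * ((real n - 2 * real h) / 2 ^ n)"
      unfolding a b using h by (simp add: of_nat_diff power_one_over field_simps)
    then show ?thesis
      using D by (simp only:)
  qed
  have "((\<lambda>e. noise n e A x) has_real_derivative
      (\<Sum>y\<in>A. - 2 * ((real n - 2 * real (hdist x y)) / 2 ^ n))) (at (1 / 2))"
    unfolding noise_def using hdist_le[of x] assms(1)
    by (intro DERIV_sum deriv) (simp add: cube_def)
  also have "(\<Sum>y\<in>A. - 2 * ((real n - 2 * real (hdist x y)) / 2 ^ n)) = - 2 * deg1_part n A x"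
    unfolding deg1_part_eq[OF assms] sum_distrib_left[symmetric] sum_divide_distrib ..
  finally show ?thesis .
qed

section \<open>Second-order expansion of the moment at noise one half\<close>

text \<open>One application of l'Hopital's rule suffices: the quotient of the derivatives is
  \<open>alpha / 2\<close> times the difference quotient of \<open>t powr (alpha - 1)\<close> at
  \<open>m\<close>.\<close>

lemma powr_taylor2:
  fixes m alpha :: real
  assumes "m > 0"
  shows "((\<lambda>t. (t powr alpha - m powr alpha - alpha * m powr (alpha - 1) * (t - m)) / (t - m)\<^sup>2)
    \<longlongrightarrow> alpha * (alpha - 1) / 2 * m powr (alpha - 2)) (at m)"
proof (rule lhopital)
  have pos: "\<forall>\<^sub>F t in at m. 0 < t"
    using assms eventually_at_in_open'[of "{0<..}" m] by simp
  have D: "((\<lambda>t. t powr b) has_real_derivative b * t powr (b - 1)) (at t)" if "t > 0" for t b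
    using that by (rule has_real_derivative_powr)
  show "\<forall>\<^sub>F t in at m. ((\<lambda>t. t powr alpha - m powr alpha - alpha * m powr (alpha - 1) * (t - m))
      has_real_derivative alpha * t powr (alpha - 1) - alpha * m powr (alpha - 1)) (at t)"
    using pos by eventually_elim (auto intro!: derivative_eq_intros D)
  show "\<forall>\<^sub>F t in at m. ((\<lambda>t. (t - m)\<^sup>2) has_real_derivative 2 * (t - m)) (at t)"
    by (intro always_eventually allI) (auto intro!: derivative_eq_intros)
  have lim: "((\<lambda>t. t powr b) \<longlongrightarrow> m powr b) (at m)" for b
    using assms by (intro tendsto_intros) auto
  have "((\<lambda>t. t powr alpha - m powr alpha - alpha * m powr (alpha - 1) * (t - m)) \<longlongrightarrow>
      m powr alpha - m powr alpha - alpha * m powr (alpha - 1) * (m - m)) (at m)"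
    by (intro tendsto_intros lim)
  then show "((\<lambda>t. t powr alpha - m powr alpha - alpha * m powr (alpha - 1) * (t - m)) \<longlongrightarrow> 0) (at m)"
    by simp
  have "((\<lambda>t. (t - m)\<^sup>2) \<longlongrightarrow> (m - m)\<^sup>2) (at m)"
    by (intro tendsto_intros)
  then show "((\<lambda>t. (t - m)\<^sup>2) \<longlongrightarrow> 0) (at m)"
    by simp
  show "\<forall>\<^sub>F t in at m. (t - m)\<^sup>2 \<noteq> 0" "\<forall>\<^sub>F t in at m. 2 * (t - m) \<noteq> 0"
    by (auto simp: eventually_at_filter)
  have "((\<lambda>t. (t powr (alpha - 1) - m powr (alpha - 1)) / (t - m)) \<longlongrightarrow> (alpha - 1) * m powr (alpha - 1 - 1)) (at m)"
    using D[OF assms, of "alpha - 1"] by (simp add: has_field_derivative_iff)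
  then have "((\<lambda>t. alpha / 2 * ((t powr (alpha - 1) - m powr (alpha - 1)) / (t - m))) \<longlongrightarrow>
      alpha / 2 * ((alpha - 1) * m powr (alpha - 1 - 1))) (at m)"
    by (intro tendsto_intros)
  moreover have "alpha / 2 * (u / v) = alpha * u / (2 * v)" for u v
    by simp
  ultimately show "((\<lambda>t. (alpha * t powr (alpha - 1) - alpha * m powr (alpha - 1)) / (2 * (t - m))) \<longlongrightarrow>
      alpha * (alpha - 1) / 2 * m powr (alpha - 2)) (at m)"
    by (simp only: right_diff_distrib[of alpha, symmetric]) (simp add: mult.assoc)
qed

text \<open>A nonempty \<open>A\<close> has \<open>m > 0\<close>, as the Taylor expansion demands.
  Its coefficient is multiplied by the mean square of the slopes from
  \<open>DERIV_noise_half\<close>, which is four times the weight.\<close>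

lemma moment_half:
  assumes A: "A \<subseteq> cube n" "A \<noteq> {}"
  defines "m \<equiv> card A / 2 ^ n"
  shows "((\<lambda>e. (moment n alpha e A - m powr alpha) / (e - 1 / 2)\<^sup>2) \<longlongrightarrow>
    2 * alpha * (alpha - 1) * m powr (alpha - 2) * deg1_weight n A) (at (1 / 2))"
proof -
  define c where "c = alpha * (alpha - 1) / 2 * m powr (alpha - 2)"
  define p where "p t = (t powr alpha - m powr alpha - alpha * m powr (alpha - 1) * (t - m)) / (t - m)\<^sup>2" for t
  \<comment> \<open>Extending the Taylor quotient continuously by its limit at \<open>m\<close>
    makes the expansion exact for every \<open>t\<close>, also where the noise equals
    \<open>m\<close>.\<close>
  define r where "r t = (if t = m then c else p t)" for t
  have "m > 0"
    using A finite_subset_cube by (auto simp: m_def card_gt_0_iff)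
  then have "(p \<longlongrightarrow> c) (at m)"
    using powr_taylor2 unfolding p_def c_def by blast
  then have "(r \<longlongrightarrow> c) (at m)"
    by (rule Lim_transform_eventually) (simp add: eventually_at_filter r_def)
  then have r_cont: "isCont r m"
    by (simp add: isCont_def r_def)
  have r_eq: "t powr alpha = m powr alpha + alpha * m powr (alpha - 1) * (t - m) + (t - m)\<^sup>2 * r t" for t
    by (auto simp: r_def p_def)
  have moment: "moment n alpha e A - m powr alpha = (\<Sum>x\<in>cube n. (noise n e A x - m)\<^sup>2 * r (noise n e A x)) / 2 ^ n" for e
  proof -
    have "(\<Sum>x\<in>cube n. noise n e A x - m) = 0"
      by (simp add: sum_subtractf sum_noise[OF A(1)] m_def)
    then have "(\<Sum>x\<in>cube n. alpha * m powr (alpha - 1) * (noise n e A x - m)) = 0"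
      by (simp flip: sum_distrib_left)
    moreover have "(\<Sum>x\<in>cube n. noise n e A x powr alpha) = (\<Sum>x\<in>cube n. m powr alpha
        + alpha * m powr (alpha - 1) * (noise n e A x - m) + (noise n e A x - m)\<^sup>2 * r (noise n e A x))"
      by (intro sum.cong refl r_eq)
    ultimately show ?thesis
      unfolding moment_def expect_def by (simp add: sum.distrib add_divide_distrib)
  qed
  have lim: "((\<lambda>e. ((noise n e A x - m) / (e - 1 / 2))\<^sup>2 * r (noise n e A x)) \<longlongrightarrow>
      (- 2 * deg1_part n A x)\<^sup>2 * r m) (at (1 / 2))" if x: "x \<in> cube n" for x
  proof (intro tendsto_intros)
    note D = DERIV_noise_half[OF x A(1)] and half = noise_half[OF x, of A, folded m_def]
    show "((\<lambda>e. (noise n e A x - m) / (e - 1 / 2)) \<longlongrightarrow> - 2 * deg1_part n A x) (at (1 / 2))"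
      using D by (simp add: has_field_derivative_iff half)
    have "((\<lambda>e. noise n e A x) \<longlongrightarrow> m) (at (1 / 2))"
      using DERIV_isCont[OF D] half by (simp add: isCont_def)
    then show "((\<lambda>e. r (noise n e A x)) \<longlongrightarrow> r m) (at (1 / 2))"
      by (rule isCont_tendsto_compose[OF r_cont])
  qed
  have "((\<lambda>e. (\<Sum>x\<in>cube n. ((noise n e A x - m) / (e - 1 / 2))\<^sup>2 * r (noise n e A x)) / 2 ^ n) \<longlongrightarrow>
      (\<Sum>x\<in>cube n. (- 2 * deg1_part n A x)\<^sup>2 * r m) / 2 ^ n) (at (1 / 2))"
    by (intro tendsto_divide tendsto_sum tendsto_const lim) simp_all
  moreover have "(\<Sum>x\<in>cube n. ((noise n e A x - m) / (e - 1 / 2))\<^sup>2 * r (noise n e A x)) / 2 ^ n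
      = (moment n alpha e A - m powr alpha) / (e - 1 / 2)\<^sup>2" for e
    unfolding moment by (simp add: power_divide sum_divide_distrib mult.commute)
  moreover have "(\<Sum>x\<in>cube n. (- 2 * deg1_part n A x)\<^sup>2 * r m) / 2 ^ n
      = 2 * alpha * (alpha - 1) * m powr (alpha - 2) * deg1_weight n A"
    by (simp add: power_mult_distrib sum_deg1_part_square r_def c_def flip: sum_distrib_left sum_distrib_right)
  ultimately show ?thesis by simp
qed

lemma moment_half_less:
  assumes "A \<subseteq> cube n" "B \<subseteq> cube n" "card A = card B" "deg1_weight n A < deg1_weight n B" "alpha > 1"
  shows "\<forall>\<^sub>F e in at_left (1 / 2). moment n alpha e A < moment n alpha e B"
proof -
  have fin: "finite A" "finite B"
    using assms finite_subset_cube by blast+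
  \<comment> \<open>If \<open>A\<close> were empty, equal cardinality would make \<open>B\<close>
    empty too, and the weights could not differ.\<close>
  have "A \<noteq> {}"
    using assms(3,4) fin by auto
  then have ne: "A \<noteq> {}" "B \<noteq> {}"
    using assms(3) fin by auto
  then have "card B > 0"
    using fin by (simp add: card_gt_0_iff)
  then have "2 * alpha * (alpha - 1) * (card A / 2 ^ n) powr (alpha - 2) * deg1_weight n A
      < 2 * alpha * (alpha - 1) * (card B / 2 ^ n) powr (alpha - 2) * deg1_weight n B"
    using assms(4,5) unfolding assms(3) by (intro mult_strict_left_mono mult_pos_pos) simp_all
  from eventually_less_if_tendsto_less[OF moment_half[OF assms(1) ne(1)] moment_half[OF assms(2) ne(2)] this]
  have "\<forall>\<^sub>F e in at (1 / 2). moment n alpha e A < moment n alpha e B"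
    unfolding assms(3)
  proof (rule eventually_elim2[OF _ eventually_neq_at_within[of "1 / 2 :: real" "1 / 2" UNIV]])
    fix e :: real
    assume "(moment n alpha e A - (card B / 2 ^ n) powr alpha) / (e - 1 / 2)\<^sup>2
       < (moment n alpha e B - (card B / 2 ^ n) powr alpha) / (e - 1 / 2)\<^sup>2" "e \<noteq> 1 / 2"
    then show "moment n alpha e A < moment n alpha e B"
      by (simp add: divide_less_cancel)
  qed
  then show ?thesis
    by (rule filter_leD[OF at_le, rotated]) simp
qed

text \<open>The cube has finitely many subsets, so one threshold serves all pairs at once.\<close>

lemma eventually_moment_half_less:
  assumes "alpha > 1"
  shows "\<forall>\<^sub>F e in at_left (1 / 2). \<forall>A\<in>Pow (cube n). \<forall>B\<in>Pow (cube n).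
    card A = card B \<longrightarrow> deg1_weight n A < deg1_weight n B \<longrightarrow> moment n alpha e A < moment n alpha e B"
  using moment_half_less[OF _ _ _ _ assms]
  by (intro eventually_ball_finite ballI) (auto simp: eventually_conj_iff)

section \<open>Balanced sets\<close>

lemma support_dictator: "support (Suc n) dictator = Cons True ` cube n"
  by (auto simp: support_def dictator_def elim!: cube_SucE)

text \<open>A face has exactly \<open>2 ^ n\<close> points, so a set of that size inside a face
  fills it.\<close>

lemma isometric_dictator:
  assumes "A \<subseteq> cube (Suc n)" "card A = 2 ^ n" "i < Suc n" "\<forall>x\<in>A. x ! i = c"
  shows "isometric (Suc n) A (support (Suc n) dictator)"
proof -
  obtain B where B: "isometric (Suc n) A B" "\<forall>x\<in>B. hd x = True"
    using isometric_face_head[OF assms(1,3,4)] by metis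
  have "B \<subseteq> Cons True ` cube n"
    using isometric_subset[OF B(1)] B(2) by (fastforce simp: cube_Suc)
  moreover have "card B = card (Cons True ` cube n)"
    using isometric_card[OF B(1)] assms(2) by (simp add: card_image)
  ultimately show ?thesis
    using B(1) card_subset_eq[of "Cons True ` cube n" B] by (simp add: support_dictator)
qed

text \<open>Pythagoras for the centred indicator \<open>p\<close>: its square is constantly 1/4, and
  its degree-one coefficients are those of \<open>A\<close> because the characters have mean
  zero.\<close>

lemma balanced_deficit:
  assumes "A \<subseteq> cube (Suc n)" "card A = 2 ^ n"
  shows "(\<Sum>x\<in>cube (Suc n). (of_bool (x \<in> A) - 1 / 2 - deg1_part (Suc n) A x)\<^sup>2)
    = 2 ^ Suc n * (1 / 4 - deg1_weight (Suc n) A)"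
proof -
  let ?N = "Suc n"
  define p where "p x = (of_bool (x \<in> A) - 1 / 2 :: real)" for x
  have "(\<Sum>x\<in>cube ?N. p x * sgn_coord i x) = 2 ^ ?N * deg1_coeff ?N A i" if "i < ?N" for i
    using sum_of_bool_subset[OF assms(1), of "sgn_coord i"] sum_sgn_coord[OF that]
    by (simp add: p_def left_diff_distrib sum_subtractf deg1_coeff_def flip: sum_divide_distrib)
  then have 1: "(\<Sum>x\<in>cube ?N. p x * deg1_part ?N A x) = 2 ^ ?N * deg1_weight ?N A"
    unfolding sum_deg1_part_mult deg1_weight_def
    by (simp add: power2_eq_square sum_distrib_left mult_ac del: sum.lessThan_Suc)
  have p2: "(p x)\<^sup>2 = 1 / 4" for x
    by (cases "x \<in> A") (simp_all add: p_def power2_eq_square)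
  have 2: "(\<Sum>x\<in>cube ?N. (p x)\<^sup>2) = 2 ^ ?N * (1 / 4)"
    unfolding p2 by simp
  have "(\<Sum>x\<in>cube ?N. (p x - deg1_part ?N A x)\<^sup>2) =
      (\<Sum>x\<in>cube ?N. (p x)\<^sup>2) - 2 * (\<Sum>x\<in>cube ?N. p x * deg1_part ?N A x)
      + (\<Sum>x\<in>cube ?N. (deg1_part ?N A x)\<^sup>2)"
    by (simp add: power2_diff sum.distrib sum_subtractf sum_distrib_left mult.assoc)
  also have "\<dots> = 2 ^ ?N * (1 / 4 - deg1_weight ?N A)"
    unfolding 1 2 sum_deg1_part_square by (simp add: algebra_simps)
  finally show ?thesis
    by (simp add: p_def)
qed

lemma balanced_deg1_weight_le:
  assumes "A \<subseteq> cube (Suc n)" "card A = 2 ^ n"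
  shows "deg1_weight (Suc n) A \<le> 1 / 4"
proof -
  have "0 \<le> 2 ^ Suc n * (1 / 4 - deg1_weight (Suc n) A)"
    unfolding balanced_deficit[OF assms, symmetric] by (intro sum_nonneg) simp
  then show ?thesis
    by (simp add: zero_le_mult_iff power_le_zero_eq)
qed

lemma deg1_part_flip:
  assumes "x \<in> cube n" "i < n"
  shows "deg1_part n A (flip i x) = deg1_part n A x - 2 * deg1_coeff n A i * sgn_coord i x"
proof -
  have "deg1_part n A x - deg1_part n A (flip i x)
      = (\<Sum>j<n. if i = j then 2 * deg1_coeff n A j * sgn_coord j x else 0)"
    unfolding deg1_part_def sum_subtractf[symmetric]
    by (intro sum.cong refl) (simp add: sgn_coord_flip[OF assms])
  also have "\<dots> = 2 * deg1_coeff n A i * sgn_coord i x"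
    using assms(2) by simp
  finally show ?thesis by simp
qed

text \<open>Equality in Parseval makes the indicator affine in the characters, so a coordinate with a
  nonzero coefficient is pivotal at every point and hence decides membership.\<close>

lemma balanced_deg1_weight_eq:
  assumes A: "A \<subseteq> cube (Suc n)" "card A = 2 ^ n" and eq: "deg1_weight (Suc n) A = 1 / 4"
  shows "isometric (Suc n) A (support (Suc n) dictator)"
proof -
  let ?N = "Suc n"
  have "(\<Sum>x\<in>cube ?N. (of_bool (x \<in> A) - 1 / 2 - deg1_part ?N A x)\<^sup>2) = 0"
    unfolding balanced_deficit[OF A] eq by simp
  then have ind: "of_bool (x \<in> A) = 1 / 2 + deg1_part ?N A x" if "x \<in> cube ?N" for x
    using that by (subst (asm) sum_nonneg_eq_0_iff) auto
  obtain i where i: "i < ?N" "deg1_coeff ?N A i \<noteq> 0"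
    using eq unfolding deg1_weight_def by (metis (no_types, lifting) lessThan_iff power_zero_numeral
        sum.neutral zero_neq_numeral divide_eq_0_iff zero_neq_one)
  have pivot: "2 * deg1_coeff ?N A i * sgn_coord i x = of_bool (x \<in> A) - of_bool (flip i x \<in> A)" if "x \<in> cube ?N" for x
    using ind[OF that] ind[of "flip i x"] deg1_part_flip[OF that i(1), of A] that by simp
  \<comment> \<open>The left side of \<open>pivot\<close> is nonzero, so at a point of
    \<open>A\<close> both sides equal 1, and the sign of the coefficient fixes
    \<open>x ! i\<close>.\<close>
  have "x ! i = (deg1_coeff ?N A i < 0)" if "x \<in> A" for x
    using pivot[OF subsetD[OF A(1) that]] that i(2) by (auto simp: sgn_coord_def of_bool_def split: if_splits)
  then show ?thesis
    using isometric_dictator[OF A i(1)] by blast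
qed

lemma card_dictator: "card (support (Suc n) dictator) = 2 ^ n"
  by (simp add: support_dictator card_image)

text \<open>The coefficient of the first coordinate alone gives 1/4, which is already the upper
  bound for balanced sets.\<close>

lemma deg1_weight_dictator: "deg1_weight (Suc n) (support (Suc n) dictator) = 1 / 4"
proof -
  let ?D = "support (Suc n) dictator"
  have "(\<Sum>y\<in>?D. sgn_coord 0 y) = (\<Sum>y\<in>?D. - 1)"
    by (intro sum.cong refl) (simp add: support_def dictator_def sgn_coord_def)
  then have "deg1_coeff (Suc n) ?D 0 = - 1 / 2"
    by (simp add: deg1_coeff_def card_dictator)
  then have "1 / 4 \<le> deg1_weight (Suc n) ?D"
    unfolding deg1_weight_def
    using member_le_sum[of 0 "{..<Suc n}" "\<lambda>i. (deg1_coeff (Suc n) ?D i)\<^sup>2"]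
    by (simp add: power2_eq_square)
  then show ?thesis
    using balanced_deg1_weight_le[OF support_subset card_dictator, of n] by linarith
qed

text \<open>Balanced sets of weight 1/4 tie with the dictator by isometry; all others have smaller
  weight and lose strictly.\<close>

lemma dictator_maximal_half:
  assumes "alpha > 1"
  shows "\<forall>\<^sub>F e in at_left (1 / 2). \<forall>A. A \<subseteq> cube (Suc n) \<longrightarrow> card A = 2 ^ n \<longrightarrow>
    moment (Suc n) alpha e A \<le> moment (Suc n) alpha e (support (Suc n) dictator)"
  using eventually_moment_half_less[OF assms, of "Suc n"]
proof eventually_elim
  case (elim e)
  show ?case
  proof (intro allI impI)
    fix A assume A: "A \<subseteq> cube (Suc n)" "card A = 2 ^ n"
    show "moment (Suc n) alpha e A \<le> moment (Suc n) alpha e (support (Suc n) dictator)"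
    proof (cases "deg1_weight (Suc n) A = 1 / 4")
      case True
      then show ?thesis
        using isometric_moment[OF balanced_deg1_weight_eq[OF A True]] by simp
    next
      case False
      then have "deg1_weight (Suc n) A < deg1_weight (Suc n) (support (Suc n) dictator)"
        using balanced_deg1_weight_le[OF A] by (simp add: deg1_weight_dictator)
      then have "moment (Suc n) alpha e A < moment (Suc n) alpha e (support (Suc n) dictator)"
        using elim A support_subset[of "Suc n" dictator] by (simp add: card_dictator)
      then show ?thesis by simp
    qed
  qed
qed

text \<open>The segment of half the cube is the face where the first coordinate is
  \<open>False\<close>, the mirror image of the dictator.\<close>

lemma dictator_maximal_0:
  assumes "alpha > 1"
  shows "\<forall>\<^sub>F e in at_right 0. \<forall>A\<in>{A. A \<subseteq> cube (Suc n) \<and> card A = 2 ^ n}.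
    moment (Suc n) alpha e A \<le> moment (Suc n) alpha e (support (Suc n) dictator)"
proof -
  have "face_section True (lex_set (Suc n) (2 ^ n)) = {}"
    by (simp add: face_section_lex_set)
  then have "\<forall>x\<in>lex_set (Suc n) (2 ^ n). x ! 0 = False"
    using lex_set_subset[of "Suc n" "2 ^ n"] by (fastforce simp: face_section_def elim!: cube_SucE)
  then have "isometric (Suc n) (lex_set (Suc n) (2 ^ n)) (support (Suc n) dictator)"
    using lex_set_optimal[of "2 ^ n" "Suc n"]
    by (intro isometric_dictator[of _ _ 0 False] lex_set_subset) auto
  from isometric_moment[OF this] show ?thesis
    using lex_set_maximal_small_noise[of "2 ^ n" "Suc n" alpha] assms by simp
qed

section \<open>From subsets of the cube to Boolean functions\<close>

theorem theorem1:
  fixes n :: nat and alpha m :: real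
  assumes "n \<ge> 1" and "alpha > 1"
    and "\<exists>j::nat. j \<le> 2 ^ n \<and> m = real j / 2 ^ n"
  shows "(\<exists>eps0. 0 < eps0 \<and> eps0 \<le> 1/2 \<and>
            (\<forall>eps. 0 < eps \<and> eps < eps0 \<longrightarrow>
               lexfun n m \<in> Bm n m \<and>
               (\<forall>f\<in>Bm n m. Mfun n alpha eps (lexfun n m) \<ge> Mfun n alpha eps f)))
       \<and> (\<exists>eps1. 0 \<le> eps1 \<and> eps1 < 1/2 \<and>
            (\<forall>eps. eps1 < eps \<and> eps < 1/2 \<longrightarrow>
               (\<forall>f\<in>Bm n m. (\<forall>g\<in>Bm n m. Mfun n alpha eps f \<ge> Mfun n alpha eps g) \<longrightarrow>
                  (\<forall>g\<in>Bm n m. W1 n g \<le> W1 n f))))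
       \<and> (m = 1/2 \<longrightarrow>
            (\<exists>eps0 eps1. 0 < eps0 \<and> eps0 \<le> 1/2 \<and> 0 \<le> eps1 \<and> eps1 < 1/2 \<and>
               (\<forall>eps. (0 < eps \<and> eps < eps0) \<or> (eps1 < eps \<and> eps < 1/2) \<longrightarrow>
                  (\<forall>f\<in>Bm n (1/2). Mfun n alpha eps dictator \<ge> Mfun n alpha eps f))))"
proof -
  obtain k where k: "k \<le> 2 ^ n" "m = real k / 2 ^ n"
    using assms(3) by blast
  obtain N where N: "n = Suc N"
    using assms(1) by (cases n) auto
  have near_0: "\<exists>b. 0 < b \<and> b \<le> 1 / 2 \<and> (\<forall>e. 0 < e \<and> e < b \<longrightarrow> P e)"
    if P: "\<forall>\<^sub>F e in at_right 0. P e" for P :: "real \<Rightarrow> bool"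
  proof -
    obtain b where "0 < b" "\<forall>e>0. e < b \<longrightarrow> P e"
      using P eventually_at_right_field[of P 0] by blast
    then show ?thesis by (intro exI[of _ "min b (1 / 2)"]) auto
  qed
  have near_half: "\<exists>b. 0 \<le> b \<and> b < 1 / 2 \<and> (\<forall>e. b < e \<and> e < 1 / 2 \<longrightarrow> P e)"
    if P: "\<forall>\<^sub>F e in at_left (1 / 2). P e" for P :: "real \<Rightarrow> bool"
  proof -
    obtain b where "b < 1 / 2" "\<forall>e>b. e < 1 / 2 \<longrightarrow> P e"
      using P eventually_at_left_field[of P "1 / 2"] by blast
    then show ?thesis by (intro exI[of _ "max b 0"]) auto
  qed
  \<comment> \<open>A function enters only through its support, so comparing functions of mean
    \<open>m\<close> means comparing the finitely many sets of size \<open>k\<close>.\<close>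
  have Bm: "f \<in> Bm n m \<longleftrightarrow> card (support n f) = k" for f
    by (simp add: Bm_def bmean_eq k(2))
  have lex: "support n (lexfun n m) = lex_set n k"
    by (simp add: support_def lexfun_def lex_set_def k(2))
  have "\<exists>b. 0 < b \<and> b \<le> 1 / 2 \<and> (\<forall>e. 0 < e \<and> e < b \<longrightarrow>
      (\<forall>A\<in>{A. A \<subseteq> cube n \<and> card A = k}. moment n alpha e A \<le> moment n alpha e (lex_set n k)))"
    by (rule near_0[OF lex_set_maximal_small_noise[OF k(1) assms(2)]])
  then have part1: "\<exists>eps0. 0 < eps0 \<and> eps0 \<le> 1/2 \<and>
            (\<forall>eps. 0 < eps \<and> eps < eps0 \<longrightarrow>
               lexfun n m \<in> Bm n m \<and>
               (\<forall>f\<in>Bm n m. Mfun n alpha eps (lexfun n m) \<ge> Mfun n alpha eps f))"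
  proof (elim exE conjE, intro exI conjI allI impI ballI)
    fix b e f
    assume max: "\<forall>e. 0 < e \<and> e < b \<longrightarrow>
      (\<forall>A\<in>{A. A \<subseteq> cube n \<and> card A = k}. moment n alpha e A \<le> moment n alpha e (lex_set n k))"
      and e: "0 < e \<and> e < b"
    show "lexfun n m \<in> Bm n m"
      using lex_set_optimal[OF k(1)] by (simp add: Bm lex)
    show "Mfun n alpha e f \<le> Mfun n alpha e (lexfun n m)" if "f \<in> Bm n m"
      using max e that support_subset[of n f] by (simp add: Bm lex Mfun_eq)
  qed
  have "\<exists>b. 0 \<le> b \<and> b < 1 / 2 \<and> (\<forall>e. b < e \<and> e < 1 / 2 \<longrightarrow>
      (\<forall>A\<in>Pow (cube n). \<forall>B\<in>Pow (cube n). card A = card B \<longrightarrow>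
        deg1_weight n A < deg1_weight n B \<longrightarrow> moment n alpha e A < moment n alpha e B))"
    by (rule near_half[OF eventually_moment_half_less[OF assms(2)]])
  then have part2: "\<exists>eps1. 0 \<le> eps1 \<and> eps1 < 1/2 \<and>
            (\<forall>eps. eps1 < eps \<and> eps < 1/2 \<longrightarrow>
               (\<forall>f\<in>Bm n m. (\<forall>g\<in>Bm n m. Mfun n alpha eps f \<ge> Mfun n alpha eps g) \<longrightarrow>
                  (\<forall>g\<in>Bm n m. W1 n g \<le> W1 n f)))"
  proof (elim exE conjE, intro exI conjI allI impI ballI)
    fix b e f g
    assume less: "\<forall>e. b < e \<and> e < 1 / 2 \<longrightarrow>
      (\<forall>A\<in>Pow (cube n). \<forall>B\<in>Pow (cube n). card A = card B \<longrightarrow>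
        deg1_weight n A < deg1_weight n B \<longrightarrow> moment n alpha e A < moment n alpha e B)"
      and e: "b < e \<and> e < 1 / 2" and f: "f \<in> Bm n m" and g: "g \<in> Bm n m"
      and max: "\<forall>g\<in>Bm n m. Mfun n alpha e g \<le> Mfun n alpha e f"
    \<comment> \<open>By contraposition: a competitor of larger weight would have a strictly larger
      moment.\<close>
    have "\<not> moment n alpha e (support n f) < moment n alpha e (support n g)"
      using max g by (auto simp: Mfun_eq not_less)
    then show "W1 n g \<le> W1 n f"
      using less e f g support_subset unfolding W1_eq Bm by (metis PowI not_less)
  qed
  have part3: "\<exists>eps0 eps1. 0 < eps0 \<and> eps0 \<le> 1/2 \<and> 0 \<le> eps1 \<and> eps1 < 1/2 \<and>
               (\<forall>eps. (0 < eps \<and> eps < eps0) \<or> (eps1 < eps \<and> eps < 1/2) \<longrightarrow>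
                  (\<forall>f\<in>Bm n (1/2). Mfun n alpha eps dictator \<ge> Mfun n alpha eps f))"
  proof -
    have Bhalf: "f \<in> Bm n (1 / 2) \<longleftrightarrow> card (support n f) = 2 ^ N" for f
    proof -
      have "f \<in> Bm n (1 / 2) \<longleftrightarrow> real (card (support n f)) = real (2 ^ N)"
        by (auto simp: Bm_def bmean_eq N field_simps)
      then show ?thesis by (simp only: of_nat_eq_iff)
    qed
    obtain b0 where b0: "0 < b0" "b0 \<le> 1 / 2" "\<forall>e. 0 < e \<and> e < b0 \<longrightarrow>
        (\<forall>A\<in>{A. A \<subseteq> cube n \<and> card A = 2 ^ N}. moment n alpha e A \<le> moment n alpha e (support n dictator))"
      using near_0[OF dictator_maximal_0[OF assms(2), of N]] unfolding N by blast
    obtain b1 where b1: "0 \<le> b1" "b1 < 1 / 2" "\<forall>e. b1 < e \<and> e < 1 / 2 \<longrightarrow>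
        (\<forall>A. A \<subseteq> cube n \<longrightarrow> card A = 2 ^ N \<longrightarrow> moment n alpha e A \<le> moment n alpha e (support n dictator))"
      using near_half[OF dictator_maximal_half[OF assms(2), of N]] unfolding N by blast
    show ?thesis
      using b0 b1 support_subset by (intro exI[of _ b0] exI[of _ b1]) (auto simp: Mfun_eq Bhalf)
  qed
  show ?thesis
    using part1 part2 part3 by blast
qed

end
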